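(* Assume the following conjecture: there exist constants $A>0$ and $B>0$ such that for all integers $m\ge 2$ and $c$ with $\gcd(c,m)=1$, the smallest prime $p$ with $p\equiv c \pmod m$ satisfies $p\le B\,m(\log m)^A$. Then for every integer $a$ there are infinitely many composite positive integers $n$ such that $p-a\mid n-a$ for each prime $p\mid n$. Moreover, for every integer $a$ there exist a constant $C>0$ and a constant $c_0>0$ such that for all sufficiently large real $X$, the number of $a$-Carmichael numbers $n\le X$ is at least $$c_0\,X^{\frac{C}{(\log\log\log X)^2}}.$$
   Context: For an integer $a$, an $a$-Carmichael number is a composite positive integer $n$ such that $p-a\mid n-a$ for every prime $p\mid n$. (The convention is that $0\mid m$ if and only if $m=0$.) *)

theory Defs
  imports Complex_Main "HOL-Number_Theory.Number_Theory"
begin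

text \<open>On \<^typ>\<open>int\<close>, \<^const>\<open>prime\<close> holds only of positive numbers, and \<open>0 dvd m\<close> holds
  iff \<open>m = 0\<close>, so a prime factor \<open>p = a\<close> forces \<open>n = a\<close>.\<close>

definition carmichael :: "int \<Rightarrow> int \<Rightarrow> bool" where
  "carmichael a n \<longleftrightarrow> n > 1 \<and> \<not> prime n \<and> (\<forall>p. prime p \<and> p dvd n \<longrightarrow> p - a dvd n - a)"

definition smallest_prime_in_class :: "int \<Rightarrow> int \<Rightarrow> int \<Rightarrow> bool" where
  "smallest_prime_in_class c m p \<longleftrightarrow>
     prime p \<and> [p = c] (mod m) \<and> (\<forall>q. prime q \<and> [q = c] (mod m) \<longrightarrow> p \<le> q)"

text \<open>That a prime congruent to \<open>c\<close> modulo \<open>m\<close> exists at all is Dirichlet's theorem.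
  The existential quantifier over \<open>p\<close> makes this part of the hypothesis.\<close>

definition least_prime_conjecture :: bool where
  "least_prime_conjecture \<longleftrightarrow>
     (\<exists>A>0. \<exists>B>0. \<forall>m c. m \<ge> 2 \<and> gcd c m = 1 \<longrightarrow>
        (\<exists>p. smallest_prime_in_class c m p \<and>
             real_of_int p \<le> B * real_of_int m * ln (real_of_int m) powr A))"

end

theory Submission
  imports Defs "HOL-Real_Asymp.Real_Asymp" "HOL-Library.FuncSet"
begin

text \<open>An \<open>a\<close>-Carmichael number need not be squarefree, and this replaces the usual appeal to the
  Davenport constant. Let \<open>p\<^sub>0 = M + a\<close> be prime, let \<open>P\<close> be a set of primes \<open>p\<close> coprime to \<open>M\<close> with
  \<open>p - a dvd M\<close>, and let \<open>E\<close> be an exponent of the units modulo \<open>M\<close>. Some \<open>R \<subseteq> P\<close> with at most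
  \<open>log 2 M\<close> elements has the property that any product of primes of \<open>P\<close> becomes 1 modulo \<open>M\<close> after
  multiplication by powers (with exponents below \<open>E\<close>) of elements of \<open>R\<close>. So each small subset of
  \<open>P - R\<close> yields its own \<open>a\<close>-Carmichael number.

  It remains to have \<open>P\<close> large compared to \<open>E * log 2 M\<close>. Start from \<open>w\<close> primes of size \<open>exp (O(w))\<close>.
  For the products \<open>m\<close> of subsets of them, the conjecture and the pigeonhole principle give many primes
  \<open>q = m * k\<^sub>1 + 1\<close> with a common small \<open>k\<^sub>1\<close>. Let \<open>L\<close> be the product of these \<open>W\<close> primes, where
  \<open>W\<close> is about \<open>2 ^ w\<close>: the units modulo \<open>L\<close> have an exponent of size only \<open>exp (O(w\<^sup>2))\<close>.
  In the same way the divisors \<open>d\<close> of \<open>L\<close> give the primes \<open>p = d * k\<^sub>2 + a\<close> of \<open>P\<close>, and finally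
  \<open>p\<^sub>0 = L * k\<^sub>2 * k\<^sub>3 + a\<close>. As \<open>ln (card P)\<close> is of order \<open>W\<close> while \<open>ln p = O(W * w\<^sup>2)\<close>, the count up to
  \<open>X\<close> is at least \<open>X powr (c / w\<^sup>2)\<close>, and \<open>w\<close> may be taken of order \<open>ln (ln (ln X))\<close>.\<close>

section \<open>Primes in progressions with a common small cofactor\<close>

text \<open>The conjecture with its constants as parameters, since all later constants are built
  from \<open>A\<close> and \<open>B\<close>.\<close>

definition least_prime_bound :: "real \<Rightarrow> real \<Rightarrow> bool" where
  "least_prime_bound A B \<longleftrightarrow> (\<forall>m c :: int. m \<ge> 2 \<longrightarrow> coprime c m \<longrightarrow>
     (\<exists>p. prime p \<and> [p = c] (mod m) \<and> real_of_int p \<le> B * real_of_int m * ln (real_of_int m) powr A))"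

lemma least_prime_boundE:
  fixes m c :: int
  assumes "least_prime_bound A B" "m \<ge> 2" "coprime c m"
  obtains p where "prime p" "[p = c] (mod m)"
    "real_of_int p \<le> B * real_of_int m * ln (real_of_int m) powr A"
  using assms unfolding least_prime_bound_def by blast

text \<open>If \<open>a\<close> is itself prime, the least prime congruent to \<open>a\<close> modulo \<open>d\<close> may be the useless \<open>a\<close>.
  Prescribing another residue modulo 3 rules this out, at the price of requiring \<open>d\<close> coprime to 3.\<close>

lemma ex_small_cofactor_prime:
  fixes a d :: int
  assumes lpb: "least_prime_bound A B" "A > 0" "B > 0"
    and a: "a \<noteq> 0" and d: "d > 2 * \<bar>a\<bar>" "coprime d a" "\<not> 3 dvd d" "real_of_int d \<le> Z"
  shows "\<exists>k. k \<ge> 1 \<and> \<not> 3 dvd k \<and> coprime k a \<and> prime (d * k + a) \<and>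
           real_of_int k \<le> 3 * B * ln (3 * Z) powr A + 1"
proof -
  have d0: "d \<ge> 1" using d(1) by linarith
  have p3: "prime (3::int)" by simp
  have c3: "coprime d 3" using p3 d(3) by (metis coprime_commute prime_imp_coprime)
  \<comment> \<open>\<open>b\<close> avoids the residues 0 and \<open>a\<close> modulo 3: the first
    keeps the class coprime to 3, the second keeps 3 from dividing \<open>p - a = d * k\<close>, so
    that \<open>k\<close> is nonzero and prime to 3.\<close>
  obtain b :: int where b: "\<not> 3 dvd b" "\<not> 3 dvd b - a"
  proof (cases "3 dvd 1 - a")
    case True
    hence "\<not> 3 dvd (2::int)" "\<not> 3 dvd 2 - a" by presburger+
    thus ?thesis using that by blast
  next
    case False thus ?thesis using that[of 1] by auto
  qed
  obtain c where c: "[c = a] (mod d)" "[c = b] (mod 3)"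
    using binary_chinese_remainder_int[OF c3] by blast
  have "coprime c d" using c(1) d(2) by (metis cong_imp_coprime cong_sym coprime_commute)
  moreover have "coprime c 3" using c(2) b(1) p3
    by (metis cong_dvd_iff coprime_commute prime_imp_coprime)
  ultimately have cc: "coprime c (3 * d)" by simp
  obtain p where p: "prime p" "[p = c] (mod 3 * d)"
    and pb: "real_of_int p \<le> B * real_of_int (3 * d) * ln (real_of_int (3 * d)) powr A"
    using least_prime_boundE[OF lpb(1) _ cc] d0 by auto
  have pa: "[p = a] (mod d)" using p(2) c(1) by (meson cong_modulus_mult cong_trans cong_dvd_modulus dvd_triv_right)
  have pb3: "[p = b] (mod 3)" using p(2) c(2) by (meson cong_trans cong_dvd_modulus dvd_triv_left)
  from pa have "d dvd p - a" by (simp add: cong_iff_dvd_diff)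
  then obtain k where k: "p = d * k + a" by (metis dvdE diff_add_cancel)
  have n3: "\<not> 3 dvd p - a" 
  proof
    assume "3 dvd p - a"
    moreover have "3 dvd p - b" using pb3 by (simp add: cong_iff_dvd_diff)
    ultimately have "3 dvd (p - a) - (p - b)" by (rule dvd_diff)
    thus False using b(2) by simp
  qed
  hence k3: "\<not> 3 dvd k" using k by auto
  have p2: "p \<ge> 2" using p(1) prime_ge_2_int by blast
  have k1: "k \<ge> 1"
  proof (rule ccontr)
    assume "\<not> k \<ge> 1"
    moreover have "k \<noteq> 0" using k3 by auto
    ultimately have "d * k \<le> d * (-1)" using d0 by (intro mult_left_mono) auto
    thus False using k p2 d(1) by linarith
  qed
  have dk: "d \<le> d * k" using d0 k1 by (simp add: mult_le_cancel_left1)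
  have ka: "coprime k a"
  proof (rule coprimeI)
    fix g assume g: "g dvd k" "g dvd a"
    hence "g dvd p" using k by simp
    hence "is_unit g \<or> p dvd g" using p(1) 
      by (metis dvdE irreducibleD' prime_elem_imp_irreducible prime_imp_prime_elem)
    moreover have "\<not> p dvd g"
    proof
      assume "p dvd g"
      hence "p dvd a" using g(2) dvd_trans by blast
      \<comment> \<open>Here \<open>d > 2 * |a|\<close> enters:
        \<open>p >= d - |a| > |a|\<close>.\<close>
      moreover have "p > \<bar>a\<bar>" using k dk d(1) by linarith
      ultimately show False using dvd_imp_le_int[of a p] a by auto
    qed
    ultimately show "is_unit g" by blast
  qed
  \<comment> \<open>The 3 comes from the modulus \<open>3 * d\<close>; the summand 1 pays for
    \<open>- a <= d\<close> after division by \<open>d\<close>.\<close>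
  have "real_of_int k \<le> 3 * B * ln (3 * Z) powr A + 1"
  proof -
    have "ln (3 * real_of_int d) powr A \<le> ln (3 * Z) powr A"
      using d0 d(4) lpb(2) by (intro powr_mono2) auto
    hence "B * (3 * real_of_int d) * ln (3 * real_of_int d) powr A \<le> B * (3 * real_of_int d) * ln (3 * Z) powr A"
      using lpb(3) d0 by (intro mult_left_mono) auto
    with pb have "real_of_int p \<le> B * (3 * real_of_int d) * ln (3 * Z) powr A" by simp
    moreover have "real_of_int p = real_of_int d * real_of_int k + real_of_int a" using k by simp
    moreover have "- real_of_int a \<le> real_of_int d" using d(1) by linarith
    ultimately have "real_of_int d * real_of_int k \<le> real_of_int d * (3 * B * ln (3 * Z) powr A + 1)"
      by (simp add: algebra_simps)
    thus ?thesis using d0 by simp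
  qed
  thus ?thesis using k k1 k3 ka p(1) by blast
qed

text \<open>Pigeonhole: the cofactors lie between 1 and a power of a logarithm, so one value
  \<open>k\<close> serves a large share of \<open>D\<close>. The side conditions on \<open>k\<close>
  ensure that multiplying an admissible modulus by \<open>k\<close> leaves it admissible for
  \<open>ex_small_cofactor_prime\<close>.\<close>

lemma ex_common_cofactor_primes:
  fixes a :: int and D :: "int set"
  assumes lpb: "least_prime_bound A B" "A > 0" "B > 0"
    and a: "a \<noteq> 0" and fin: "finite D" and ne: "D \<noteq> {}"
    and d: "\<And>d. d \<in> D \<Longrightarrow> d > 2 * \<bar>a\<bar> \<and> coprime d a \<and> \<not> 3 dvd d \<and> real_of_int d \<le> Z"
  shows "\<exists>k D'. k \<ge> 1 \<and> \<not> 3 dvd k \<and> coprime k a \<and> D' \<subseteq> D \<and> (\<forall>d\<in>D'. prime (d * k + a)) \<and>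
           real_of_int k \<le> 3 * B * ln (3 * Z) powr A + 1 \<and>
           real (card D) \<le> (3 * B * ln (3 * Z) powr A + 1) * real (card D')"
proof -
  define K where "K = 3 * B * ln (3 * Z) powr A + 1"
  have "\<forall>d\<in>D. \<exists>k. k \<ge> 1 \<and> \<not> 3 dvd k \<and> coprime k a \<and> prime (d * k + a) \<and> real_of_int k \<le> K"
    using ex_small_cofactor_prime[OF lpb a] d unfolding K_def by blast
  then obtain f where f: "\<And>d. d \<in> D \<Longrightarrow> f d \<ge> 1 \<and> \<not> 3 dvd f d \<and> coprime (f d) a \<and> prime (d * f d + a) \<and> real_of_int (f d) \<le> K"
    by metis
  define I where "I = {1..\<lfloor>K\<rfloor>}"
  have fI: "f \<in> D \<rightarrow> I" using f by (auto simp: I_def le_floor_iff)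
  have K1: "K \<ge> 1" using lpb by (simp add: K_def)
  have Ine: "I \<noteq> {}" "finite I" using K1 by (auto simp: I_def)
  have "real (card I) \<le> K" using K1 by (simp add: I_def)
  obtain k where k: "k \<in> I" "card D \<le> card (f -` {k} \<inter> D) * card I"
    using pigeonhole_card[OF fI fin Ine(2) Ine(1)] by auto
  have "real (card D) \<le> real (card (f -` {k} \<inter> D)) * real (card I)" using k(2) by (metis of_nat_le_iff of_nat_mult)
  also have "\<dots> \<le> real (card (f -` {k} \<inter> D)) * K" using \<open>real (card I) \<le> K\<close> by (intro mult_left_mono) auto
  finally have le: "real (card D) \<le> K * real (card (f -` {k} \<inter> D))" by (simp add: mult.commute)
  have "f -` {k} \<inter> D \<noteq> {}"
  proof
    assume "f -` {k} \<inter> D = {}"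
    with k(2) fin ne show False by simp
  qed
  then obtain d0 where "d0 \<in> D" "f d0 = k" by auto
  hence "k \<ge> 1 \<and> \<not> 3 dvd k \<and> coprime k a \<and> real_of_int k \<le> K" using f by blast
  moreover have "prime (d * k + a)" if "d \<in> f -` {k} \<inter> D" for d
    using f[of d] that by auto
  ultimately show ?thesis using le unfolding K_def[symmetric] by blast
qed

section \<open>Products of distinct primes\<close>

lemma prod_primes_dvd:
  fixes S :: "int set"
  assumes "finite S" "\<And>p. p \<in> S \<Longrightarrow> prime p" "\<And>p. p \<in> S \<Longrightarrow> p dvd x"
  shows "\<Prod>S dvd x"
  using assms
proof (induction S rule: finite_induct)
  case (insert p S)
  have "coprime p (\<Prod>S)"
    using insert by (intro prod_coprime_right) (metis insertI1 insertI2 primes_coprime)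
  with insert show ?case by (simp add: divides_mult)
qed simp

text \<open>Bounds how many primes of \<open>P\<close> have to be discarded because they divide
  \<open>M\<close>.\<close>

lemma card_primes_dvd:
  fixes S :: "int set" and x :: int
  assumes "finite S" "\<And>p. p \<in> S \<Longrightarrow> prime p" "\<And>p. p \<in> S \<Longrightarrow> p dvd x" "x > 0"
  shows "2 ^ card S \<le> x"
proof -
  have "(\<Prod>p\<in>S. 2) \<le> \<Prod>S" using assms(2) by (intro prod_mono) (auto dest: prime_ge_2_int)
  also have "\<dots> \<le> x" using prod_primes_dvd[OF assms(1-3)] assms(4) by (auto intro: zdvd_imp_le)
  finally show ?thesis by simp
qed

text \<open>The primes of \<open>S\<close> that divide a subset product are exactly the members of
  the subset.\<close>

lemma inj_on_prod_primes:
  fixes S :: "int set"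
  assumes "finite S" "\<And>p. p \<in> S \<Longrightarrow> prime p"
  shows "inj_on (\<lambda>I. \<Prod>I) (Pow S)"
proof (rule inj_onI)
  have mem: "p \<in> I \<longleftrightarrow> p dvd \<Prod>I" if "I \<subseteq> S" "p \<in> S" for I p
  proof -
    have "finite I" using that assms finite_subset by blast
    hence "p dvd \<Prod>I \<longleftrightarrow> (\<exists>q\<in>I. p dvd q)" using that assms(2) by (simp add: prime_dvd_prod_iff)
    moreover have "q = p" if "q \<in> I" "p dvd q" for q
      using primes_dvd_imp_eq[of p q] assms(2) \<open>I \<subseteq> S\<close> \<open>p \<in> S\<close> that by auto
    ultimately show ?thesis by (metis dvd_refl)
  qed
  fix I J assume IJ: "I \<in> Pow S" "J \<in> Pow S" "\<Prod>I = \<Prod>J"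
  hence "p \<in> I \<longleftrightarrow> p \<in> J" if "p \<in> S" for p using mem[of I p] mem[of J p] that by (metis PowD)
  thus "I = J" using IJ by blast
qed

section \<open>Units modulo \<open>M\<close>\<close>

text \<open>\<open>R\<close> is a largest subset of \<open>P\<close> whose subset products are distinct modulo \<open>M\<close>. A coincidence
  among the subset products of \<open>insert p R\<close> then expresses \<open>p\<close> through elements of \<open>R\<close>, with
  exponent \<open>E - 1\<close> playing the role of inversion.\<close>

lemma ex_small_inverting_subset:
  fixes M :: int and P :: "int set"
  assumes M: "M > 0" and fin: "finite P" and cop: "\<And>p. p \<in> P \<Longrightarrow> coprime p M"
    and E: "E \<ge> 1" "\<And>x. coprime x M \<Longrightarrow> [x ^ E = 1] (mod M)"
  shows "\<exists>R\<subseteq>P. 2 ^ card R \<le> M \<and>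
           (\<forall>S\<subseteq>P. \<exists>f. (\<forall>r. f r < E) \<and> [\<Prod>S * (\<Prod>r\<in>R. r ^ f r) = 1] (mod M))"
proof -
  define good where "good R \<longleftrightarrow> R \<subseteq> P \<and> inj_on (\<lambda>I. \<Prod>I mod M) (Pow R)" for R
  have "good {}" by (simp add: good_def)
  have "\<exists>R. good R \<and> (\<forall>R'. good R' \<longrightarrow> card R' \<le> card R)"
    using ex_has_greatest_nat[of good "{}" card "Suc (card P)"] \<open>good {}\<close> fin
    by (auto simp: good_def less_Suc_eq_le intro: card_mono)
  then obtain R where R: "good R" "\<And>R'. good R' \<Longrightarrow> card R' \<le> card R" by blast
  have RP: "R \<subseteq> P" and injR: "inj_on (\<lambda>I. \<Prod>I mod M) (Pow R)" using R(1) by (auto simp: good_def)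
  have finR: "finite R" using RP fin finite_subset by blast
  have copI: "coprime (\<Prod>I) M" if "I \<subseteq> P" for I using cop that by (intro prod_coprime_left) auto
  have "card (Pow R) \<le> card {0..<M}"
    using M by (intro card_inj_on_le[OF injR]) auto
  hence "int (2 ^ card R) \<le> M" using finR M by (simp add: card_Pow le_nat_iff)
  hence c2: "2 ^ card R \<le> M" by simp
  \<comment> \<open>\<open>rep x\<close> means that the inverse of \<open>x\<close> modulo
    \<open>M\<close> is a product of powers of elements of \<open>R\<close>. Exponents are unbounded
    at first, so that products only add them; at the end they are reduced modulo
    \<open>E\<close>.\<close>
  define rep where "rep x \<longleftrightarrow> (\<exists>f. [x * (\<Prod>r\<in>R. r ^ f r) = 1] (mod M))" for x
  have rep_mult: "rep (x * y)" if "rep x" "rep y" for x y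
  proof -
    from that obtain f g where fg: "[x * (\<Prod>r\<in>R. r ^ f r) = 1] (mod M)" "[y * (\<Prod>r\<in>R. r ^ g r) = 1] (mod M)"
      unfolding rep_def by blast
    have "x * y * (\<Prod>r\<in>R. r ^ (f r + g r)) = (x * (\<Prod>r\<in>R. r ^ f r)) * (y * (\<Prod>r\<in>R. r ^ g r))"
      by (simp add: power_add prod.distrib algebra_simps)
    with cong_mult[OF fg] show ?thesis unfolding rep_def by (metis mult_1)
  qed
  have rep_aux: "rep p" if "p \<in> P" "I \<subseteq> R" "J \<subseteq> R" "[p * \<Prod>I = \<Prod>J] (mod M)" for p I J
  proof -
    \<comment> \<open>From \<open>p * \<Prod>I = \<Prod>J\<close> modulo \<open>M\<close> follows
      \<open>p * \<Prod>I * \<Prod>J ^ (E - 1) = \<Prod>J ^ E = 1\<close>, and \<open>f\<close>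
      collects these exponents.\<close>
    define f where "f r = of_bool (r \<in> I) + (E - 1) * of_bool (r \<in> J)" for r
    have PR: "(\<Prod>r\<in>R. r ^ of_bool (r \<in> H)) = \<Prod>H" if "H \<subseteq> R" for H
      using that finR by (intro prod.mono_neutral_cong_right) auto
    have "(\<Prod>r\<in>R. r ^ f r) = (\<Prod>r\<in>R. r ^ of_bool (r \<in> I)) * (\<Prod>r\<in>R. (r ^ of_bool (r \<in> J)) ^ (E - 1))"
      unfolding prod.distrib[symmetric] by (intro prod.cong) (auto simp: f_def)
    also have "(\<Prod>r\<in>R. (r ^ of_bool (r \<in> J)) ^ (E - 1)) = (\<Prod>r\<in>R. r ^ of_bool (r \<in> J)) ^ (E - 1)"
      by (simp add: prod_power_distrib)
    finally have eq: "(\<Prod>r\<in>R. r ^ f r) = \<Prod>I * \<Prod>J ^ (E - 1)"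
      using that by (simp add: PR)
    have "p * (\<Prod>r\<in>R. r ^ f r) = (p * \<Prod>I) * \<Prod>J ^ (E - 1)" by (simp add: eq algebra_simps)
    also have "[\<dots> = \<Prod>J * \<Prod>J ^ (E - 1)] (mod M)" using that(4) by (intro cong_mult) auto
    also have "\<Prod>J * \<Prod>J ^ (E - 1) = \<Prod>J ^ E" using E(1) by (metis Suc_diff_1 less_eq_Suc_le One_nat_def power_Suc)
    also have "[\<Prod>J ^ E = 1] (mod M)" using E(2) copI that RP by blast
    finally show ?thesis unfolding rep_def by blast
  qed
  have rep_P: "rep p" if p: "p \<in> P" for p
  proof (cases "p \<in> R")
    case True
    thus ?thesis using rep_aux[OF p, of "{}" "{p}"] by simp
  next
    case False
    have "\<not> good (insert p R)" using R(2)[of "insert p R"] False finR by auto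
    hence "\<not> inj_on (\<lambda>I. \<Prod>I mod M) (Pow (insert p R))" using RP p by (auto simp: good_def)
    then obtain I J where IJ: "I \<subseteq> insert p R" "J \<subseteq> insert p R" "I \<noteq> J" "\<Prod>I mod M = \<Prod>J mod M"
      unfolding inj_on_def by blast
    \<comment> \<open>Exactly one of \<open>I\<close> and \<open>J\<close> contains
      \<open>p\<close>: if both did, \<open>p\<close> could be cancelled, and then, as when neither
      does, injectivity on subsets of \<open>R\<close> would force \<open>I = J\<close>. By symmetry
      take \<open>p\<close> in \<open>I\<close>.\<close>
    have main: "rep p" if IJ: "I \<subseteq> insert p R" "J \<subseteq> insert p R" "I \<noteq> J" "[\<Prod>I = \<Prod>J] (mod M)" and pI: "p \<in> I" for I J
    proof -
      have fIJ: "finite I" "finite J" using IJ finR by (auto intro: finite_subset)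
      have PI: "\<Prod>I = p * \<Prod>(I - {p})" using pI fIJ by (simp add: prod.remove)
      show ?thesis
      proof (cases "p \<in> J")
        case True
        have "\<Prod>J = p * \<Prod>(J - {p})" using True fIJ by (simp add: prod.remove)
        with IJ PI cop[OF p] have "[\<Prod>(I - {p}) = \<Prod>(J - {p})] (mod M)" by (simp add: cong_mult_lcancel)
        hence "\<Prod>(I - {p}) mod M = \<Prod>(J - {p}) mod M" by (simp add: unique_euclidean_semiring_class.cong_def)
        hence "I - {p} = J - {p}" by (rule inj_onD[OF injR]) (use IJ(1,2) in auto)
        with pI True IJ(3) show ?thesis by blast
      next
        case False
        show ?thesis using IJ False PI by (intro rep_aux[OF p, of "I - {p}" J]) auto
      qed
    qed
    have cg: "[\<Prod>I = \<Prod>J] (mod M)" using IJ(4) by (simp add: unique_euclidean_semiring_class.cong_def)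
    have "p \<in> I \<or> p \<in> J"
    proof (rule ccontr)
      assume "\<not> ?thesis"
      hence "I \<in> Pow R" "J \<in> Pow R" using IJ by auto
      with inj_onD[OF injR IJ(4)] IJ(3) show False by blast
    qed
    thus ?thesis using main[OF IJ(1-3) cg] main[OF IJ(2,1) _ cong_sym[OF cg]] IJ(3) by blast
  qed
  have rep_S: "rep (\<Prod>S)" if "S \<subseteq> P" for S
  proof -
    have "finite S" using that fin finite_subset by blast
    thus ?thesis using that
    proof (induction S rule: finite_induct)
      case empty show ?case unfolding rep_def by (intro exI[of _ "\<lambda>_. 0"]) simp
    next
      case (insert p S) thus ?case using rep_mult rep_P by simp
    qed
  qed
  have "\<exists>f. (\<forall>r. f r < E) \<and> [\<Prod>S * (\<Prod>r\<in>R. r ^ f r) = 1] (mod M)" if "S \<subseteq> P" for S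
  proof -
    from rep_S[OF that] obtain f where f: "[\<Prod>S * (\<Prod>r\<in>R. r ^ f r) = 1] (mod M)" unfolding rep_def by blast
    have "[(\<Prod>r\<in>R. r ^ (f r mod E)) = (\<Prod>r\<in>R. r ^ f r)] (mod M)"
    proof (rule cong_prod)
      fix r assume "r \<in> R"
      hence "[r ^ E = 1] (mod M)" using RP cop E(2) by blast
      hence "[(r ^ E) ^ (f r div E) * r ^ (f r mod E) = 1 ^ (f r div E) * r ^ (f r mod E)] (mod M)"
        by (intro cong_mult cong_pow) auto
      moreover have "(r ^ E) ^ (f r div E) * r ^ (f r mod E) = r ^ f r"
        by (simp flip: power_mult power_add)
      ultimately show "[r ^ (f r mod E) = r ^ f r] (mod M)" by (simp add: cong_sym_eq)
    qed
    hence "[\<Prod>S * (\<Prod>r\<in>R. r ^ (f r mod E)) = 1] (mod M)" using f by (meson cong_mult cong_refl cong_trans)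
    thus ?thesis using E(1) by (intro exI[of _ "\<lambda>r. f r mod E"]) auto
  qed
  thus ?thesis using RP c2 by blast
qed

text \<open>As \<open>h\<close> may share factors with \<open>\<Prod>Q\<close>, congruences modulo
  each do not combine to the product. Instead factor
  \<open>y ^ h - 1 = (y - 1) * (\<Sum>i<h. y ^ i)\<close> with
  \<open>y = x ^ (l * totient h)\<close>: the first factor is divisible by \<open>\<Prod>Q\<close>,
  and the second is congruent to \<open>h\<close>, hence to 0, modulo \<open>h\<close>. This costs
  the extra exponent \<open>h\<close>.\<close>

lemma pow_cong_1_mult:
  fixes L h x :: int
  assumes Q: "finite Q" "\<And>q. q \<in> Q \<Longrightarrow> prime q" "\<And>q. q \<in> Q \<Longrightarrow> q - 1 dvd int l"
    and h: "h \<ge> 1" and x: "coprime x (\<Prod>Q * h)"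
  shows "[x ^ (l * totient (nat h) * nat h) = 1] (mod \<Prod>Q * h)"
proof -
  have euler: "[x ^ totient (nat m) = 1] (mod m)" if "coprime x m" "m \<ge> 1" for m
    using that residues.euler_theorem[of m x] by (cases "m = 1") (auto simp: residues_def)
  define y where "y = x ^ (l * totient (nat h))"
  have xQ: "coprime x (\<Prod>Q)" and xh: "coprime x h" using x by auto
  have "q dvd y - 1" if q: "q \<in> Q" for q
  proof -
    have pq: "prime q" using Q q by blast
    have "q dvd \<Prod>Q" using q Q(1) by (metis dvd_prodI)
    hence cq: "coprime x q" using xQ by (metis coprime_divisors dvd_refl)
    have "q \<ge> 1" using pq prime_ge_1_int by blast
    have "totient (nat q) = nat q - 1" using pq prime_int_nat_transfer totient_prime by blast
    hence "[x ^ (nat q - 1) = 1] (mod q)" using euler[OF cq \<open>q \<ge> 1\<close>] by simp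
    moreover have "int (nat q - 1) = q - 1" using \<open>q \<ge> 1\<close> by linarith
    hence "nat q - 1 dvd l" using Q(3)[OF q] int_dvd_int_iff by metis
    then obtain c where "l = (nat q - 1) * c" by blast
    ultimately have "[y = 1] (mod q)" unfolding y_def
      using cong_pow[of "x ^ (nat q - 1)" 1 q "c * totient (nat h)"] by (simp add: power_mult[symmetric] mult.assoc)
    thus ?thesis by (simp add: cong_iff_dvd_diff)
  qed
  hence LY: "\<Prod>Q dvd y - 1" using prod_primes_dvd[OF Q(1,2)] by blast
  have "[y = 1] (mod h)" unfolding y_def
    using cong_pow[OF euler[OF xh h], of l] by (simp add: power_mult[symmetric] mult.commute)
  hence "[(\<Sum>i<nat h. y ^ i) = (\<Sum>i<nat h. 1 ^ i)] (mod h)" by (intro cong_sum cong_pow)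
  hence "h dvd (\<Sum>i<nat h. y ^ i)" using h by (simp add: cong_dvd_iff)
  hence "\<Prod>Q * h dvd y ^ nat h - 1" using LY by (simp add: power_diff_1_eq mult_dvd_mono)
  thus ?thesis by (simp add: cong_iff_dvd_diff y_def power_mult)
qed

section \<open>Counting \<open>a\<close>-Carmichael numbers from a set of primes\<close>

text \<open>For every \<open>t\<close>-subset \<open>S\<close> of \<open>P - R\<close> the number \<open>p\<^sub>0 * \<Prod>S * (\<Prod>r\<in>R. r ^ f r)\<close>, with \<open>f\<close> making the
  last two factors cancel modulo \<open>M\<close>, is congruent to \<open>a\<close> modulo \<open>M\<close>. Its prime divisors outside
  \<open>R\<close> recover \<open>S\<close>.\<close>

lemma card_carmichael_ge_choose:
  fixes a M p\<^sub>0 Y :: int and P :: "int set"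
  assumes M: "M > 0" "M \<le> 2 ^ b" and p0: "prime p\<^sub>0" "p\<^sub>0 = M + a" "p\<^sub>0 \<le> Y"
    and fin: "finite P"
    and P: "\<And>p. p \<in> P \<Longrightarrow> prime p \<and> coprime p M \<and> p - a dvd M \<and> p \<le> Y"
    and E: "E \<ge> 1" "\<And>x. coprime x M \<Longrightarrow> [x ^ E = 1] (mod M)" and t: "t \<ge> 1"
  shows "(card P - b) choose t \<le> card {n. carmichael a n \<and> n \<le> Y ^ (1 + t + E * b)}"
proof -
  obtain R where R: "R \<subseteq> P" "2 ^ card R \<le> M"
    and Rf: "\<forall>S\<subseteq>P. \<exists>f. (\<forall>r. f r < E) \<and> [\<Prod>S * (\<Prod>r\<in>R. r ^ f r) = 1] (mod M)"
    using ex_small_inverting_subset[OF M(1) fin _ E] P by metis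
  from Rf have "\<forall>S. \<exists>f. S \<subseteq> P \<longrightarrow> (\<forall>r. f r < E) \<and> [\<Prod>S * (\<Prod>r\<in>R. r ^ f r) = 1] (mod M)" by blast
  then obtain F where F: "\<And>S r. S \<subseteq> P \<Longrightarrow> F S r < E"
    "\<And>S. S \<subseteq> P \<Longrightarrow> [\<Prod>S * (\<Prod>r\<in>R. r ^ F S r) = 1] (mod M)" by metis
  have finR: "finite R" using R fin finite_subset by blast
  have cR: "card R \<le> b"
  proof -
    have "(2::int) ^ card R \<le> 2 ^ b" using R(2) M(2) by linarith
    thus ?thesis by simp
  qed
  define N where "N S = \<Prod>S * (\<Prod>r\<in>R. r ^ F S r)" for S
  define \<S> where "\<S> = {S. S \<subseteq> P - R \<and> card S = t}"
  have Y1: "Y \<ge> 1" using p0 prime_ge_1_int[of p\<^sub>0] by linarith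
  have p00: "p\<^sub>0 > 1" using p0(1) prime_gt_1_int by blast
  have finS: "finite S" "S \<subseteq> P" if "S \<in> \<S>" for S
    using that fin by (auto simp: \<S>_def intro: finite_subset)
  have pN: "p \<in> S \<union> R" if "S \<in> \<S>" "prime p" "p dvd N S" for S p
  proof -
    have "(\<exists>q\<in>S. p dvd q) \<or> (\<exists>r\<in>R. p dvd r ^ F S r)"
      using that finS[OF that(1)] finR by (simp add: N_def prime_dvd_mult_iff prime_dvd_prod_iff)
    hence "\<exists>q\<in>S \<union> R. p dvd q" using that(2) prime_dvd_power by blast
    then obtain q where q: "q \<in> S \<union> R" "p dvd q" by blast
    hence "prime q" using P finS[OF that(1)] R(1) by blast
    thus ?thesis using q that(2) primes_dvd_imp_eq by blast
  qed
  have Nmem: "S = {p \<in> P - R. p dvd N S}" if "S \<in> \<S>" for S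
  proof (intro equalityI subsetI)
    fix p assume p: "p \<in> S"
    hence "p dvd \<Prod>S" using finS[OF that] by (metis dvd_prodI)
    thus "p \<in> {p \<in> P - R. p dvd N S}" using p that by (auto simp: N_def \<S>_def)
  next
    fix p assume "p \<in> {p \<in> P - R. p dvd N S}"
    thus "p \<in> S" using pN[OF that] P by blast
  qed
  have inj: "inj_on (\<lambda>S. p\<^sub>0 * N S) \<S>"
  proof (rule inj_onI)
    fix S S' assume S: "S \<in> \<S>" "S' \<in> \<S>" and eq: "p\<^sub>0 * N S = p\<^sub>0 * N S'"
    have "N S = N S'" using eq p00 by simp
    thus "S = S'" using Nmem[OF S(1)] Nmem[OF S(2)] by simp
  qed
  have Pge: "p \<ge> 1" if "p \<in> P" for p using P[OF that] prime_ge_1_int by blast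
  have img: "p\<^sub>0 * N S \<in> {n. carmichael a n \<and> n \<le> Y ^ (1 + t + E * b)}" if S: "S \<in> \<S>" for S
  proof -
    have cS: "card S = t" using S by (simp add: \<S>_def)
    have Rpos: "(\<Prod>r\<in>R. r ^ F S r) \<ge> 1" using Pge R(1) by (intro prod_ge_1) auto
    have "S \<noteq> {}" using cS t by auto
    then obtain p where p: "p \<in> S" by blast
    have "p dvd N S" using Nmem[OF S] p by blast
    moreover have "\<Prod>S > 0" using Pge finS(2)[OF S] by (intro prod_pos) force
    hence Npos: "N S > 0" unfolding N_def using Rpos by (intro mult_pos_pos) auto
    ultimately have "p \<le> N S" by (rule zdvd_imp_le)
    moreover have "p > 1" using P finS(2)[OF S] p prime_gt_1_int by blast
    ultimately have N1: "N S > 1" by linarith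
    have "\<not> prime (p\<^sub>0 * N S)"
      using primes_dvd_imp_eq[OF p0(1), of "p\<^sub>0 * N S"] N1 p00 by auto
    moreover have "p\<^sub>0 * N S > 1" using p00 N1 by (simp add: less_1_mult)
    moreover have "p - a dvd p\<^sub>0 * N S - a" if p: "prime p" "p dvd p\<^sub>0 * N S" for p
    proof -
      \<comment> \<open>It suffices to work modulo \<open>M\<close>, since \<open>p - a\<close>
        divides \<open>M\<close> for every prime divisor \<open>p\<close>: for \<open>p\<close> in
        \<open>P\<close> by hypothesis, for \<open>p\<^sub>0\<close> because
        \<open>p\<^sub>0 - a = M\<close>.\<close>
      have "[p\<^sub>0 * N S = a * 1] (mod M)"
        using F(2)[OF finS(2)[OF S]] p0(2) unfolding N_def by (intro cong_mult) (auto simp: cong_iff_dvd_diff)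
      hence MN: "M dvd p\<^sub>0 * N S - a" by (simp add: cong_iff_dvd_diff)
      have "p dvd p\<^sub>0 \<or> p dvd N S" using p by (simp add: prime_dvd_mult_iff)
      hence "p = p\<^sub>0 \<or> p \<in> P"
        using pN[OF S p(1)] finS[OF S] R(1) primes_dvd_imp_eq[OF p(1) p0(1)] by blast
      hence "p - a dvd M" using p0(2) P by auto
      thus ?thesis using MN dvd_trans by blast
    qed
    ultimately have car: "carmichael a (p\<^sub>0 * N S)" by (auto simp: carmichael_def)
    have "0 \<le> p \<and> p \<le> Y" if "p \<in> S" for p
    proof -
      have "p \<in> P" using that finS(2)[OF S] by blast
      thus ?thesis using P[of p] Pge[of p] by linarith
    qed
    hence "\<Prod>S \<le> (\<Prod>p\<in>S. Y)" by (rule prod_mono)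
    hence bS: "\<Prod>S \<le> Y ^ t" by (simp add: cS)
    have "(\<Prod>r\<in>R. r ^ F S r) \<le> (\<Prod>r\<in>R. Y ^ E)"
    proof (rule prod_mono, safe)
      fix r assume "r \<in> R"
      hence r: "1 \<le> r" "r \<le> Y" using P Pge R(1) by blast+
      thus "0 \<le> r ^ F S r" by simp
      have "r ^ F S r \<le> Y ^ F S r" using r by (intro power_mono) auto
      also have "\<dots> \<le> Y ^ E" using F(1)[OF finS(2)[OF S], of r] Y1 by (intro power_increasing) auto
      finally show "r ^ F S r \<le> Y ^ E" .
    qed
    also have "\<dots> = Y ^ (E * card R)" by (simp add: power_mult)
    also have "\<dots> \<le> Y ^ (E * b)" using cR Y1 by (intro power_increasing) auto
    finally have bR: "(\<Prod>r\<in>R. r ^ F S r) \<le> Y ^ (E * b)" .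
    \<comment> \<open>The exponent counts \<open>p\<^sub>0\<close> once, the \<open>t\<close> primes
      of \<open>S\<close>, and at most \<open>b\<close> primes of \<open>R\<close>, each with
      multiplicity below \<open>E\<close>.\<close>
    have "p\<^sub>0 * N S \<le> Y * (Y ^ t * Y ^ (E * b))" unfolding N_def
    proof (intro mult_mono)
      show "0 \<le> \<Prod>S * (\<Prod>r\<in>R. r ^ F S r)" using Npos by (simp add: N_def)
    qed (use bS bR p0 Y1 Rpos in auto)
    also have "\<dots> = Y ^ (1 + t + E * b)" by (simp add: power_add)
    finally show ?thesis using car by simp
  qed
  have "card P - b \<le> card (P - R)" using cR R(1) finR by (simp add: card_Diff_subset)
  hence "(card P - b) choose t \<le> card (P - R) choose t" by (rule binomial_right_mono)
  also have "\<dots> = card \<S>" unfolding \<S>_def using fin by (simp add: n_subsets)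
  also have "\<dots> \<le> card {n. carmichael a n \<and> n \<le> Y ^ (1 + t + E * b)}"
  proof (rule card_inj_on_le[OF inj])
    show "finite {n. carmichael a n \<and> n \<le> Y ^ (1 + t + E * b)}"
      by (rule finite_subset[of _ "{1..Y ^ (1 + t + E * b)}"]) (auto simp: carmichael_def)
  qed (use img in blast)
  finally show ?thesis .
qed

section \<open>Construction of the primes\<close>

text \<open>The residue \<open>1 + 2 ^ i\<close> modulo \<open>2 ^ (i + 1)\<close> fixes the 2-adic valuation of \<open>p - 1\<close>, so that
  different \<open>i\<close> give different primes.\<close>

lemma ex_many_primes:
  fixes T :: int
  assumes lpb: "least_prime_bound A B" "A > 0" "B > 0"
  shows "\<exists>C>0. \<forall>\<^sub>F w in sequentially. \<exists>R::int set. finite R \<and> card R = w \<and>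
           (\<forall>r\<in>R. prime r \<and> r > T \<and> ln (real_of_int r) \<le> C * real w)"
proof -
  have "\<exists>p. prime p \<and> [p = 1 + 2 ^ i] (mod 2 ^ (i + 1)) \<and>
      real_of_int p \<le> B * real_of_int (2 ^ (i + 1)) * ln (real_of_int (2 ^ (i + 1))) powr A"
    if "i \<ge> 1" for i :: nat
  proof -
    have "coprime (1 + 2 ^ i :: int) (2 ^ (i + 1))" using that by (simp add: coprime_right_2_iff_odd)
    moreover have "(2::int) \<le> 2 ^ (i + 1)" using power_increasing[of 1 "i + 1" "2::int"] by simp
    ultimately show ?thesis using least_prime_boundE[OF lpb(1)] by metis
  qed
  then obtain g where g: "\<And>i. i \<ge> 1 \<Longrightarrow> prime (g i)" "\<And>i. i \<ge> 1 \<Longrightarrow> [g i = 1 + 2 ^ i] (mod 2 ^ (i + 1))"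
    and gB: "\<And>i. i \<ge> 1 \<Longrightarrow> real_of_int (g i) \<le> B * 2 ^ (i + 1) * ln (2 ^ (i + 1)) powr A"
    by (simp, metis)
  have g_gt: "g i > 2 ^ i" if "i \<ge> 1" for i
  proof -
    have "[1 + (2::int) ^ i = g i] (mod 2 ^ (i + 1))" using g(2)[OF that] by (rule cong_sym)
    moreover have "(1 + (2::int) ^ i) mod 2 ^ (i + 1) = 1 + 2 ^ i"
    proof -
      have "(2::int) \<le> 2 ^ i" using that power_increasing[of 1 i "2::int"] by simp
      thus ?thesis by (intro mod_pos_pos_trivial) (auto simp del: mod_mult_self1)
    qed
    ultimately have "g i mod 2 ^ (i + 1) = 1 + 2 ^ i"
      by (metis unique_euclidean_semiring_class.cong_def)
    moreover have "g i mod 2 ^ (i + 1) \<le> g i"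
      using g(1)[OF that] prime_ge_0_int by (intro zmod_le_nonneg_dividend) blast
    ultimately show ?thesis by linarith
  qed
  have g_neq: "g i \<noteq> g j" if "1 \<le> i" "i < j" for i j
  proof
    assume eq: "g i = g j"
    have "[g j = 1 + 2 ^ j] (mod 2 ^ (i + 1))"
      using g(2)[of j] that by (intro cong_dvd_modulus[OF g(2)[of j]] le_imp_power_dvd) auto
    moreover have "[1 + (2::int) ^ j = 1] (mod 2 ^ (i + 1))"
      using that by (simp add: cong_iff_dvd_diff le_imp_power_dvd Suc_leI del: power_Suc)
    ultimately have "[1 + 2 ^ i = (1::int)] (mod 2 ^ (i + 1))"
      using g(2)[of i] that(1) eq cong_sym cong_trans by metis
    hence "(2::int) ^ (i + 1) dvd 2 ^ i" by (simp add: cong_iff_dvd_diff)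
    hence "i + 1 \<le> i" by (subst (asm) dvd_power_iff) auto
    thus False by simp
  qed
  define C where "C = \<bar>ln B\<bar> + 3 + 3 * A"
  have "\<exists>R::int set. finite R \<and> card R = w \<and> (\<forall>r\<in>R. prime r \<and> r > T \<and> ln (real_of_int r) \<le> C * real w)"
    if w: "w \<ge> 1" "2 ^ w > T" for w
  proof -
    \<comment> \<open>These \<open>w\<close> indices make every \<open>g i\<close> exceed
      \<open>2 ^ w\<close>, hence \<open>T\<close>, while \<open>i + 1 <= 3 * w\<close> keeps
      \<open>ln (g i)\<close> linear in \<open>w\<close>.\<close>
    let ?I = "{w<..2*w}"
    have inj: "inj_on g ?I"
    proof (rule inj_onI)
      fix i j assume "i \<in> ?I" "j \<in> ?I" "g i = g j"
      thus "i = j" using g_neq[of i j] g_neq[of j i] w by (cases i j rule: linorder_cases) auto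
    qed
    have "prime (g i) \<and> g i > T \<and> ln (real_of_int (g i)) \<le> C * real w" if i: "i \<in> ?I" for i
    proof -
      have i1: "i \<ge> 1" using i w by auto
      have "(2::int) ^ w \<le> 2 ^ i" using i by (intro power_increasing) auto
      hence gT: "g i > T" using g_gt[OF i1] w by linarith
      have gpos: "real_of_int (g i) > 0" using g(1)[OF i1] prime_gt_0_int by simp
      have l: "ln ((2::real) ^ (i + 1)) = real (i + 1) * ln 2" by (simp add: ln_realpow del: power_Suc)
      have l2: "0 < ln (2::real)" "ln (2::real) \<le> 1" using ln_le_minus_one[of "2::real"] by auto
      have lb: "real (i + 1) * ln 2 \<le> 3 * real w"
      proof -
        have "real (i + 1) * ln 2 \<le> real (i + 1) * 1" using l2 by (intro mult_left_mono) auto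
        also have "\<dots> \<le> 3 * real w" using i w by auto
        finally show ?thesis .
      qed
      have lpos: "real (i + 1) * ln 2 > 0" using l2 by (intro mult_pos_pos) auto
      have "ln (real_of_int (g i)) \<le> ln (B * 2 ^ (i + 1) * ln (2 ^ (i + 1)) powr A)"
        using gB[OF i1] gpos by (intro ln_mono) auto
      also have "\<dots> = ln B + real (i + 1) * ln 2 + A * ln (real (i + 1) * ln 2)"
        using lpb(3) lpos unfolding l by (simp add: ln_mult ln_powr ln_realpow del: power_Suc)
      also have "\<dots> \<le> \<bar>ln B\<bar> + 3 * real w + A * (3 * real w)"
        using lb lpb(2) ln_le_minus_one[OF lpos] by (intro add_mono mult_left_mono) auto
      also have "\<dots> \<le> \<bar>ln B\<bar> * real w + 3 * real w + A * (3 * real w)"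
        using w by (intro add_mono) (auto simp: mult_le_cancel_left1)
      also have "\<dots> = C * real w" by (simp add: C_def algebra_simps)
      finally show ?thesis using gT g(1)[OF i1] by simp
    qed
    thus ?thesis using inj by (intro exI[of _ "g ` ?I"]) (auto simp: card_image)
  qed
  moreover have "\<forall>\<^sub>F w in sequentially. w \<ge> 1 \<and> (2::int) ^ w > T"
  proof (rule eventually_sequentiallyI[of "max 1 (nat T)"], safe)
    fix w assume w: "max 1 (nat T) \<le> w"
    have "T \<le> int w" using w by linarith
    also have "int w < 2 ^ w" by (metis of_nat_less_two_power)
    finally show "T < 2 ^ w" .
  qed auto
  moreover have "C > 0" using lpb by (simp add: C_def)
  ultimately show ?thesis by (auto elim!: eventually_mono intro!: exI[of _ C])
qed

section \<open>Subset products as moduli, and primes with smooth predecessors\<close>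

lemma prod_large_primes:
  fixes a T :: int and S :: "int set"
  assumes fin: "finite S" and ne: "S \<noteq> {}" and a: "a \<noteq> 0" "T \<ge> 2 * \<bar>a\<bar> + 3"
    and S: "\<And>q. q \<in> S \<Longrightarrow> prime q \<and> q > T"
  shows "\<Prod>S > T" "coprime (\<Prod>S) a" "\<not> 3 dvd \<Prod>S"
proof -
  obtain q where q: "q \<in> S" using ne by blast
  have pos: "\<Prod>S > 0" using S by (intro prod_pos) (auto dest: prime_gt_0_int)
  have "q dvd \<Prod>S" using q fin by (metis dvd_prodI)
  hence "q \<le> \<Prod>S" using pos by (rule zdvd_imp_le)
  moreover have "q > T" using S[OF q] by blast
  ultimately show "\<Prod>S > T" by linarith
  show "coprime (\<Prod>S) a"
  proof (rule prod_coprime_left)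
    fix q assume "q \<in> S"
    hence "prime q" "q > \<bar>a\<bar>" using S[of q] a(2) by auto
    moreover from this have "\<not> q dvd a" using dvd_imp_le_int[of a q] a(1) by auto
    ultimately show "coprime q a" using prime_imp_coprime by blast
  qed
  show "\<not> 3 dvd \<Prod>S"
  proof
    assume "3 dvd \<Prod>S"
    then obtain q where q: "q \<in> S" "3 dvd q" using fin by (auto simp: prime_dvd_prod_iff)
    have "prime q" "q > 3" using S[OF q(1)] a(2) by auto
    thus False using q(2) primes_dvd_imp_eq[of 3 q] by auto
  qed
qed

text \<open>Nonempty subsets of \<open>Q\<close> give \<open>2 ^ card Q - 1\<close> distinct
  divisors of \<open>\<Prod>Q\<close>. This is at least half of \<open>2 ^ card Q\<close>, whence
  the factor 2.\<close>

lemma ex_common_cofactor_subset_products: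
  fixes a T :: int and Q :: "int set"
  assumes lpb: "least_prime_bound A B" "A > 0" "B > 0" and a: "a \<noteq> 0" "T \<ge> 2 * \<bar>a\<bar> + 3"
    and fin: "finite Q" and ne: "Q \<noteq> {}"
    and Q: "\<And>q. q \<in> Q \<Longrightarrow> prime q \<and> q > T"
    and K_def: "K = 3 * B * ln (3 * real_of_int (\<Prod>Q)) powr A + 1"
  shows "\<exists>k D. k \<ge> 1 \<and> \<not> 3 dvd k \<and> coprime k a \<and> real_of_int k \<le> K \<and> finite D \<and>
           (\<forall>d\<in>D. d > T \<and> d dvd \<Prod>Q \<and> prime (d * k + a)) \<and>
           2 ^ card Q \<le> 2 * K * real (card D) \<and> card D \<le> 2 ^ card Q"
proof -
  define D0 where "D0 = Prod ` (Pow Q - {{}})"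
  have pos: "\<Prod>Q > 0" using Q by (intro prod_pos) (auto dest: prime_gt_0_int)
  have D0: "d > T \<and> coprime d a \<and> \<not> 3 dvd d \<and> d dvd \<Prod>Q" if d: "d \<in> D0" for d
  proof -
    from d obtain S where S: "S \<subseteq> Q" "S \<noteq> {}" "d = \<Prod>S" by (auto simp: D0_def)
    have "finite S" using S fin finite_subset by blast
    moreover have "\<Prod>S dvd \<Prod>Q" using S fin by (intro prod_dvd_prod_subset) auto
    ultimately show ?thesis using prod_large_primes[of S a T] S a Q by (metis subsetD)
  qed
  have le: "real_of_int d \<le> real_of_int (\<Prod>Q)" if "d \<in> D0" for d
    using D0[OF that] pos by (simp only: of_int_le_iff) (auto intro: zdvd_imp_le)
  have fin0: "finite D0" using fin by (simp add: D0_def)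
  have inj: "inj_on Prod (Pow Q - {{}})"
    by (rule inj_on_subset[OF inj_on_prod_primes[of Q]]) (use fin Q in auto)
  have c0: "card D0 = 2 ^ card Q - 1"
    using fin unfolding D0_def by (simp add: card_image[OF inj] card_Pow)
  have W: "(2::nat) ^ card Q \<ge> 2" using fin ne power_increasing[of 1 "card Q" "2::nat"] by (simp add: Suc_leI card_gt_0_iff)
  hence "D0 \<noteq> {}" using c0 by auto
  from ex_common_cofactor_primes[OF lpb a(1) fin0 this, of "real_of_int (\<Prod>Q)"] D0 le a(2)
  obtain k D where k: "k \<ge> 1" "\<not> 3 dvd k" "coprime k a" "D \<subseteq> D0" "\<forall>d\<in>D. prime (d * k + a)"
    "real_of_int k \<le> K" "real (card D0) \<le> K * real (card D)"
    unfolding K_def by (smt (verit))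
  have "card D \<le> card D0" using k(4) fin0 by (rule card_mono[rotated])
  hence cD: "card D \<le> 2 ^ card Q" using c0 by simp
  have "2 ^ card Q \<le> 2 * card D0" using c0 W by linarith
  hence "real (2 ^ card Q) \<le> real (2 * card D0)" by (simp only: of_nat_le_iff)
  also have "\<dots> = 2 * real (card D0)" by simp
  also have "\<dots> \<le> 2 * (K * real (card D))" using k(7) by simp
  finally have "2 ^ card Q \<le> 2 * K * real (card D)" by simp
  moreover have "finite D" using k(4) fin0 finite_subset by blast
  ultimately show ?thesis using k D0 cD by (intro exI[of _ k] exI[of _ D]) auto
qed

lemma ln_prod_le:
  fixes S :: "int set"
  assumes "\<And>q. q \<in> S \<Longrightarrow> q > 0 \<and> ln (real_of_int q) \<le> c"
  shows "ln (real_of_int (\<Prod>S)) \<le> real (card S) * c"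
proof (cases "finite S")
  case True
  have "real_of_int q \<noteq> 0" if "q \<in> S" for q using assms[OF that] by auto
  hence "ln (real_of_int (\<Prod>S)) = (\<Sum>q\<in>S. ln (real_of_int q))"
    using True ln_prod[of S real_of_int] by simp
  also have "\<dots> \<le> real (card S) * c" by (rule sum_bounded_above) (use assms in blast)
  finally show ?thesis .
qed simp

lemma ln_3_le_2: "ln (3::real) \<le> 2"
  using ln_le_minus_one[of "3::real"] by simp

text \<open>The shift is 1 here: the primes \<open>q = d * k + 1\<close>, with \<open>d\<close>
  dividing the product \<open>Z\<close> of \<open>w\<close> primes, all have \<open>q - 1\<close>
  dividing \<open>l = Z * k\<close>. So \<open>2 ^ w\<close> primes, up to a power of
  \<open>w\<close>, share an \<open>l\<close> of size only exp (O(w^2)).\<close>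

lemma ex_primes_smooth_pred:
  fixes T :: int
  assumes lpb: "least_prime_bound A B" "A > 0" "B > 0"
  shows "\<exists>C>0. \<forall>\<^sub>F w in sequentially. \<exists>(Q::int set) l. finite Q \<and> l \<ge> 1 \<and>
           (\<forall>q\<in>Q. prime q \<and> q > T \<and> q - 1 dvd int l \<and> ln (real_of_int q) \<le> C * real w ^ 2) \<and>
           ln (real l) \<le> C * real w ^ 2 \<and> 2 ^ w \<le> real w powr C * real (card Q) \<and> card Q \<le> 2 ^ w"
proof -
  \<comment> \<open>5 is \<open>2 * |a| + 3\<close> for the shift \<open>a = 1\<close>.\<close>
  define T' where "T' = max T 5"
  have T': "T' \<ge> 2 * \<bar>1\<bar> + 3" by (simp add: T'_def)
  obtain C0 where C0: "C0 > 0" and ev: "\<forall>\<^sub>F w in sequentially. \<exists>R::int set. finite R \<and> card R = w \<and>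
           (\<forall>r\<in>R. prime r \<and> r > T' \<and> ln (real_of_int r) \<le> C0 * real w)"
    using ex_many_primes[OF lpb] by blast
  \<comment> \<open>\<open>f w\<close> bounds the cofactors once \<open>ln Z <= C0 * w^2\<close>,
    the 2 standing for \<open>ln 3\<close>. It has order \<open>w powr (2 * A)\<close>; one more
    power of \<open>w\<close> absorbs the constants.\<close>
  define f where "f w = 3 * B * (2 + C0 * real w ^ 2) powr A + 1" for w :: nat
  define C where "C = C0 + 2 * A + 2"
  have "\<forall>\<^sub>F w in sequentially. 2 * f w \<le> real w powr (2 * A + 1)"
    unfolding f_def using C0 lpb(2,3) by real_asymp
  moreover have "\<forall>\<^sub>F w in sequentially. real w powr (2 * A + 1) \<le> exp (real w ^ 2)"
    using lpb(2) by real_asymp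
  ultimately have "\<forall>\<^sub>F w in sequentially. \<exists>(Q::int set) l. finite Q \<and> l \<ge> 1 \<and>
           (\<forall>q\<in>Q. prime q \<and> q > T \<and> q - 1 dvd int l \<and> ln (real_of_int q) \<le> C * real w ^ 2) \<and>
           ln (real l) \<le> C * real w ^ 2 \<and> 2 ^ w \<le> real w powr C * real (card Q) \<and> card Q \<le> 2 ^ w"
    using ev eventually_ge_at_top[of 1]
  proof eventually_elim
    case (elim w)
    then obtain R :: "int set" where R: "finite R" "card R = w"
      "\<And>r. r \<in> R \<Longrightarrow> prime r \<and> r > T' \<and> ln (real_of_int r) \<le> C0 * real w" by blast
    have "R \<noteq> {}" using R elim by auto
    obtain Z where Z: "Z = \<Prod>R" by simp
    define K where "K = 3 * B * ln (3 * real_of_int (Z)) powr A + 1"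
    have Rpos: "Z > 0" unfolding Z using R(3) by (intro prod_pos) (auto dest: prime_gt_0_int)
    have "ln (real_of_int (Z)) \<le> real (card R) * (C0 * real w)"
      unfolding Z using R(3) by (intro ln_prod_le) (auto dest: prime_gt_0_int)
    hence lnR: "ln (real_of_int (Z)) \<le> C0 * real w ^ 2" by (simp add: R(2) power2_eq_square mult_ac)
    have R1: "real_of_int (Z) \<ge> 1" using Rpos by linarith
    have "ln (3 * real_of_int (Z)) \<le> 2 + C0 * real w ^ 2"
      using lnR R1 ln_3_le_2 by (simp add: ln_mult)
    hence "K \<le> f w" unfolding K_def f_def using lpb(2,3) R1
      by (intro add_mono mult_left_mono powr_mono2) auto
    hence K2: "2 * K \<le> real w powr (2 * A + 1)" using elim by linarith
    have K1: "K \<ge> 1" using lpb by (simp add: K_def)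
    have R5: "prime q \<and> q > T'" if "q \<in> R" for q using R(3)[OF that] by blast
    obtain k D where k: "k \<ge> 1" "real_of_int k \<le> K" and D: "finite D"
      "\<And>d. d \<in> D \<Longrightarrow> d > T' \<and> d dvd Z \<and> prime (d * k + 1)"
      "2 ^ w \<le> 2 * K * real (card D)" "card D \<le> 2 ^ w"
      using ex_common_cofactor_subset_products[OF lpb _ T' R(1) \<open>R \<noteq> {}\<close> R5 K_def[unfolded Z]] R(2) unfolding Z by auto
    define Q where "Q = (\<lambda>d. d * k + 1) ` D"
    define l where "l = nat (Z * k)"
    have l: "int l = Z * k" using Rpos k(1) by (simp add: l_def)
    have cQ: "card Q = card D" unfolding Q_def using k(1) by (intro card_image inj_onI) auto
    have "w \<ge> 1" using elim by simp
    have lnK: "ln (2 * K) \<le> real w ^ 2"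
    proof -
      have "2 * K \<le> exp (real w ^ 2)" using K2 elim by linarith
      thus ?thesis using K1 ln_mono[of "2 * K" "exp (real w ^ 2)"] by simp
    qed
    have ln2K: "ln (x * (2 * K)) \<le> C * real w ^ 2" if "x \<ge> 1" "ln x \<le> C0 * real w ^ 2" for x
    proof -
      have "ln (x * (2 * K)) \<le> C0 * real w ^ 2 + 1 * real w ^ 2"
        using that lnK K1 by (subst ln_mult) auto
      also have "\<dots> = (C0 + 1) * real w ^ 2" by (simp add: algebra_simps)
      also have "\<dots> \<le> C * real w ^ 2" unfolding C_def using lpb(2) by (intro mult_right_mono) auto
      finally show ?thesis .
    qed
    have R1k: "real_of_int (Z) * real_of_int k \<le> real_of_int (Z) * (2 * K)"
      using k K1 R1 by (intro mult_left_mono) auto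
    have "real l = real_of_int (Z) * real_of_int k" using l by (metis of_int_mult of_int_of_nat_eq)
    moreover have l1: "l \<ge> 1" using l mult_pos_pos[OF Rpos, of k] k(1) by linarith
    ultimately have lnl: "ln (real l) \<le> C * real w ^ 2"
      using ln2K[OF R1 lnR] R1k by (smt (verit) ln_mono of_nat_0_less_iff of_nat_1 of_nat_le_iff)
    have Qp: "prime q \<and> q > T \<and> q - 1 dvd int l \<and> ln (real_of_int q) \<le> C * real w ^ 2" if q: "q \<in> Q" for q
    proof -
      from q obtain d where d: "d \<in> D" "q = d * k + 1" by (auto simp: Q_def)
      note Dd = D(2)[OF d(1)]
      have "d \<ge> 1" using Dd T' by linarith
      hence dk: "d \<le> d * k" using k(1) by (simp add: mult_le_cancel_left1)
      have "T \<le> T'" by (simp add: T'_def)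
      hence "q > T" using dk d(2) Dd by linarith
      have "d \<le> Z" using Dd Rpos by (auto intro: zdvd_imp_le)
      have "q \<le> 2 * (d * k)" using dk \<open>d \<ge> 1\<close> d(2) by linarith
      hence "real_of_int q \<le> real_of_int (2 * (d * k))" by (simp only: of_int_le_iff)
      also have "\<dots> = 2 * (real_of_int d * real_of_int k)" by simp
      also have "\<dots> \<le> 2 * (real_of_int (Z) * K)"
        using \<open>d \<le> Z\<close> \<open>d \<ge> 1\<close> k K1 R1 by (intro mult_left_mono mult_mono) auto
      finally have "real_of_int q \<le> real_of_int (Z) * (2 * K)" by (simp add: mult_ac)
      moreover have "q > 0" using d \<open>d \<ge> 1\<close> dk by linarith
      ultimately have "ln (real_of_int q) \<le> ln (real_of_int (Z) * (2 * K))" by (intro ln_mono) simp_all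
      hence lnq: "ln (real_of_int q) \<le> C * real w ^ 2" using ln2K[OF R1 lnR] by (rule order_trans)
      have "q - 1 dvd int l" unfolding l d(2) using mult_dvd_mono[of d "Z" k k] Dd by simp
      thus ?thesis using Dd d(2) \<open>q > T\<close> lnq by blast
    qed
    have "2 * K \<le> real w powr C" 
      using K2 powr_mono[of "2 * A + 1" C "real w"] \<open>w \<ge> 1\<close> C0 by (simp add: C_def)
    hence "2 * K * real (card D) \<le> real w powr C * real (card Q)"
      unfolding cQ by (intro mult_right_mono) auto
    hence "2 ^ w \<le> real w powr C * real (card Q)" using D(3) by linarith
    moreover have "finite Q" "card Q \<le> 2 ^ w" using D(1,4) cQ by (auto simp: Q_def)
    ultimately show ?case using Qp lnl l1 by blast
  qed
  moreover have "C > 0" using C0 lpb by (simp add: C_def)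
  ultimately show ?thesis by blast
qed

section \<open>Assembling the modulus, the set of primes and the exponent, with their sizes\<close>

lemma ln_2_ge_half: "ln (2::real) \<ge> 1 / 2"
proof -
  have "ln (exp 1) \<le> ln (2 * 2 :: real)" using exp_le by (intro ln_mono) auto
  also have "ln (2 * 2 :: real) = ln 2 + ln 2" by (rule ln_mult_pos) auto
  finally show ?thesis by simp
qed

text \<open>Here \<open>M = L * h\<close> with \<open>h = k * k'\<close>, where \<open>k\<close> is
  shared by the primes of \<open>P\<close> and \<open>k'\<close> belongs to
  \<open>p\<^sub>0\<close>. Since \<open>K\<close> and \<open>K'\<close> are polylogarithmic in
  \<open>L\<close>, the exponent \<open>E\<close> exceeds \<open>l\<close> only by such
  factors.\<close>

lemma ex_carmichael_choose_bound:
  fixes a T :: int and Q :: "int set"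
  assumes lpb: "least_prime_bound A B" "A > 0" "B > 0" and a: "a \<noteq> 0" "T \<ge> 2 * \<bar>a\<bar> + 3"
    and Q: "finite Q" "Q \<noteq> {}" "\<And>q. q \<in> Q \<Longrightarrow> prime q \<and> q > T" "\<And>q. q \<in> Q \<Longrightarrow> q - 1 dvd int l"
    and l: "l \<ge> 1" and L: "L = \<Prod>Q"
    and K_def: "K = 3 * B * ln (3 * real_of_int L) powr A + 1"
    and K'_def: "K' = 3 * B * ln (3 * (real_of_int L * K)) powr A + 1"
    and H_def: "H = real_of_int L * K * K'"
  shows "\<exists>(Y::int) E b N. Y \<ge> 3 \<and> real_of_int Y \<le> 2 * H \<and> real E \<le> real l * (K * K')\<^sup>2 \<and>
           real b \<le> 2 * ln H + 1 \<and> 2 ^ card Q \<le> 2 * K * (real N + real b) \<and>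
           (\<forall>t\<ge>1. (N - b) choose t \<le> card {n. carmichael a n \<and> n \<le> Y ^ (1 + t + E * b)})"
proof -
  have LT: "L > T" "coprime L a" "\<not> 3 dvd L"
    using prod_large_primes[OF Q(1,2) a Q(3)] by (auto simp: L)
  have L4: "L > 2 * \<bar>a\<bar> + 3" using LT a by linarith
  have K1: "K \<ge> 1" "K' \<ge> 1" using lpb by (simp_all add: K_def K'_def)
  obtain k D where k: "k \<ge> 1" "\<not> 3 dvd k" "coprime k a" "real_of_int k \<le> K"
    and D: "finite D" "\<And>d. d \<in> D \<Longrightarrow> d > T \<and> d dvd L \<and> prime (d * k + a)"
      "2 ^ card Q \<le> 2 * K * real (card D)"
    using ex_common_cofactor_subset_products[OF lpb a Q(1,2,3), of K] K_def unfolding L by metis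
  define L' where "L' = L * k"
  have "L \<le> L'" using k(1) L4 by (simp add: L'_def mult_le_cancel_left1)
  hence L'4: "L' > 2 * \<bar>a\<bar> + 3" using L4 by linarith
  have L'c: "coprime L' a" using LT k by (simp add: L'_def)
  have "prime (3::int)" by simp
  hence L'3: "\<not> 3 dvd L'" using LT(3) k(2) unfolding L'_def using prime_dvd_multD by blast
  have L'K: "real_of_int L' \<le> real_of_int L * K"
    unfolding L'_def of_int_mult using k(4) L4 by (intro mult_left_mono) auto
  have L'a: "L' > 2 * \<bar>a\<bar>" using L'4 by linarith
  \<comment> \<open>This prime is \<open>p\<^sub>0\<close>. The modulus \<open>L'\<close> is
    admissible because \<open>k\<close> is coprime to \<open>a\<close> and not divisible by
    3.\<close>
  obtain k' where k': "k' \<ge> 1" "prime (L' * k' + a)" "real_of_int k' \<le> K'"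
    using ex_small_cofactor_prime[OF lpb a(1) L'a L'c L'3 L'K] unfolding K'_def by blast
  define M where "M = L' * k'"
  define h where "h = k * k'"
  have h1: "h \<ge> 1" using k(1) k'(1) mult_mono[of 1 k 1 k'] by (simp add: h_def)
  have MLh: "M = L * h" by (simp add: M_def L'_def h_def)
  have "L' \<le> M" using k'(1) L'4 by (simp add: M_def mult_le_cancel_left1)
  hence M4: "M > 2 * \<bar>a\<bar> + 3" using L'4 by linarith
  have MH: "real_of_int M \<le> H"
    using mult_mono[OF L'K k'(3)] k'(1) K1 L4 by (simp add: M_def H_def)
  have H1: "H \<ge> 1" using MH M4 by linarith
  \<comment> \<open>As \<open>ln 2 >= 1 / 2\<close>, this gives \<open>M <= 2 ^ b\<close>. So
    \<open>b\<close> bounds both the size of the inverting set and the number of primes of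
    \<open>P\<close> that divide \<open>M\<close>.\<close>
  define b where "b = nat \<lceil>2 * ln (real_of_int M)\<rceil>"
  define E where "E = l * totient (nat h) * nat h"
  define P where "P = (\<lambda>d. d * k + a) ` D"
  define P' where "P' = {p \<in> P. \<not> p dvd M}"
  define Y where "Y = M + \<bar>a\<bar>"
  have finP: "finite P" using D(1) by (simp add: P_def)
  have cP: "card P = card D" unfolding P_def using k(1) by (intro card_image inj_onI) auto
  have lnM: "ln (real_of_int M) \<ge> 0" using M4 by simp
  have bM: "real b \<le> 2 * ln (real_of_int M) + 1" "2 * ln (real_of_int M) \<le> real b"
    using lnM unfolding b_def by linarith+
  have M2b: "M \<le> 2 ^ b"
  proof -
    have "ln (real_of_int M) \<le> real b * (1/2)" using bM by simp
    also have "\<dots> \<le> real b * ln 2" using ln_2_ge_half by (intro mult_left_mono) auto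
    also have "\<dots> = ln (2 ^ b)" by (simp add: ln_realpow)
    finally have "real_of_int M \<le> 2 ^ b" using M4 by (subst (asm) ln_le_cancel_iff) auto
    hence "real_of_int M \<le> real_of_int (2 ^ b)" by simp
    thus ?thesis by (simp only: of_int_le_iff)
  qed
  have Pdvd: "p - a dvd M \<and> p \<le> Y \<and> prime p" if p: "p \<in> P" for p
  proof -
    from p obtain d where d: "d \<in> D" "p = d * k + a" by (auto simp: P_def)
    note Dd = D(2)[OF d(1)]
    have "p - a dvd L * k * k'" unfolding d(2) using dvd_mult2[OF mult_dvd_mono[of d L k k], of k'] Dd by simp
    hence dv: "p - a dvd M" by (simp add: M_def L'_def)
    hence "p - a \<le> M" using M4 by (intro zdvd_imp_le) auto
    thus ?thesis using dv Dd d(2) by (auto simp: Y_def)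
  qed
  have P': "prime p \<and> coprime p M \<and> p - a dvd M \<and> p \<le> Y" if "p \<in> P'" for p
  proof -
    have "p \<in> P" "\<not> p dvd M" using that by (auto simp: P'_def)
    thus ?thesis using Pdvd prime_imp_coprime by blast
  qed
  have E_cong: "[x ^ E = 1] (mod M)" if "coprime x M" for x
    using pow_cong_1_mult[of Q l h x] Q h1 that unfolding E_def MLh L by blast
  have E1: "E \<ge> 1" using l h1 by (simp add: E_def Suc_leI)
  have pM: "M > 0" "M + a \<le> Y" using M4 by (auto simp: Y_def)
  have main: "(card P' - b) choose t \<le> card {n. carmichael a n \<and> n \<le> Y ^ (1 + t + E * b)}" if "t \<ge> 1" for t
    by (rule card_carmichael_ge_choose[OF pM(1) M2b k'(2)[folded M_def] refl pM(2) _ P' E1 E_cong that])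
       (use finP in \<open>auto simp: P'_def\<close>)
  have "card (P - P') \<le> b"
  proof -
    have "(2::int) ^ card (P - P') \<le> M"
      using finP Pdvd M4 by (intro card_primes_dvd) (auto simp: P'_def)
    hence "(2::int) ^ card (P - P') \<le> 2 ^ b" using M2b by linarith
    thus ?thesis by simp
  qed
  moreover have "card P = card P' + card (P - P')"
    using finP by (subst card_Un_disjoint[symmetric]) (auto simp: P'_def intro: arg_cong[where f = card])
  ultimately have "real (card D) \<le> real (card P') + real b" using cP by linarith
  hence "2 * K * real (card D) \<le> 2 * K * (real (card P') + real b)" using K1 by (intro mult_left_mono) auto
  hence c: "2 ^ card Q \<le> 2 * K * (real (card P') + real b)" using D(3) by linarith
  have EK: "real E \<le> real l * (K * K')\<^sup>2"
  proof -
    have hK: "real (nat h) \<le> K * K'"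
      using mult_mono[OF k(4) k'(3)] k(1) k'(1) K1 h1 by (simp add: h_def)
    have "real (totient (nat h)) \<le> real (nat h)" by (simp add: totient_le)
    hence "real (totient (nat h)) * real (nat h) \<le> (K * K') * (K * K')"
      using hK by (intro mult_mono) auto
    hence "real l * (real (totient (nat h)) * real (nat h)) \<le> real l * ((K * K') * (K * K'))"
      by (intro mult_left_mono) auto
    thus ?thesis by (simp add: E_def power2_eq_square mult.assoc)
  qed
  have bH: "real b \<le> 2 * ln H + 1"
    using bM(1) ln_mono[of "real_of_int M" H] MH M4 by linarith
  have "Y \<ge> 3" "real_of_int Y \<le> 2 * real_of_int M" using M4 by (auto simp: Y_def)
  thus ?thesis using main c EK bH MH by (intro exI[of _ Y] exI[of _ E] exI[of _ b] exI[of _ "card P'"]) auto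
qed

lemma two_power_le_exp: "(2::real) ^ w \<le> exp (real w)"
  using exp_ge_add_one_self[of 1] power_mono[of 2 "exp 1 :: real" w] by (simp add: exp_of_nat_mult[symmetric])

text \<open>\<open>W\<close> is the number of primes in \<open>Q\<close>. It is kept as a quantity
  of its own because \<open>ln Y\<close> and \<open>ln N\<close> must be compared with a loss of
  only \<open>w^2\<close>; passing to \<open>2 ^ w\<close> would lose a further power of
  \<open>w\<close>.\<close>

lemma eventually_carmichael_choose_bound:
  fixes a :: int
  assumes lpb: "least_prime_bound A B" "A > 0" "B > 0" and a: "a \<noteq> 0"
  shows "\<exists>C>0. \<forall>\<^sub>F w in sequentially. \<exists>(Y::int) E b N W. Y \<ge> 3 \<and> W > 0 \<and> W \<le> 2 ^ w \<and>
           2 ^ w \<le> real w powr C * W \<and> ln (real_of_int Y) \<le> C * W * real w ^ 2 \<and>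
           real E \<le> exp (C * real w ^ 2) \<and> real b \<le> C * W * real w ^ 2 \<and> exp (W / 4) \<le> real N \<and>
           (\<forall>t\<ge>1. N choose t \<le> card {n. carmichael a n \<and> n \<le> Y ^ (1 + t + E * b)})"
proof -
  define T where "T = 2 * \<bar>a\<bar> + 3"
  obtain C where C: "C > 0" and ev: "\<forall>\<^sub>F w in sequentially. \<exists>(Q::int set) l. finite Q \<and> l \<ge> 1 \<and>
           (\<forall>q\<in>Q. prime q \<and> q > T \<and> q - 1 dvd int l \<and> ln (real_of_int q) \<le> C * real w ^ 2) \<and>
           ln (real l) \<le> C * real w ^ 2 \<and> 2 ^ w \<le> real w powr C * real (card Q) \<and> card Q \<le> 2 ^ w"
    using ex_primes_smooth_pred[OF lpb] by blast
  define c where "c = 2 * A + 1"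
  have c: "c > 0" using lpb by (simp add: c_def)
  \<comment> \<open>\<open>F w x\<close> bounds both cofactor bounds: \<open>K\<close> with
    \<open>x = 0\<close>, and \<open>K'\<close> with \<open>x = c * w\<close>, which dominates
    \<open>ln K\<close>.\<close>
  define F where "F w x = 3 * B * (2 + 2 ^ w * C * real w ^ 2 + x) powr A + 1" for w :: nat and x :: real
  have "\<forall>\<^sub>F w in sequentially. 2 + exp (real w) * C * real w ^ 2 + c * real w \<le> exp (2 * real w)"
    using C c by real_asymp
  moreover have "\<forall>\<^sub>F w in sequentially. 3 * B + 1 \<le> exp (real w)"
    using lpb(3) by real_asymp
  ultimately have F: "\<forall>\<^sub>F w in sequentially. \<forall>x\<in>{0..c * real w}. F w x \<le> exp (c * real w)"
  proof (eventually_elim, safe)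
    fix w x assume *: "2 + exp (real w) * C * real w ^ 2 + c * real w \<le> exp (2 * real w)" "3 * B + 1 \<le> exp (real w)"
      and x: "x \<in> {0..c * real w}"
    have "2 ^ w * C * real w ^ 2 \<le> exp (real w) * C * real w ^ 2"
      using C two_power_le_exp[of w] by (intro mult_right_mono) auto
    moreover have "0 \<le> x" "x \<le> c * real w" using x by auto
    ultimately have "2 + 2 ^ w * C * real w ^ 2 + x \<le> exp (2 * real w)" using *(1) by linarith
    hence "(2 + 2 ^ w * C * real w ^ 2 + x) powr A \<le> exp (2 * real w) powr A"
      using \<open>0 \<le> x\<close> C lpb(2) by (intro powr_mono2) auto
    also have "\<dots> = exp (2 * A * real w)" by (simp add: powr_def)
    finally have "F w x \<le> 3 * B * exp (2 * A * real w) + exp (2 * A * real w)"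
      unfolding F_def using lpb(2,3) by (intro add_mono mult_left_mono) auto
    also have "\<dots> = (3 * B + 1) * exp (2 * A * real w)" by (simp add: algebra_simps)
    also have "\<dots> \<le> exp (real w) * exp (2 * A * real w)" using * by (intro mult_right_mono) auto
    finally show "F w x \<le> exp (c * real w)" by (simp add: c_def exp_add[symmetric] algebra_simps)
  qed
  \<comment> \<open>The first two summands cover \<open>2 * ln H + 1\<close>;
    \<open>C + 4 * c\<close> is what the bound on \<open>E\<close> requires.\<close>
  define C' where "C' = 2 * (C + 2 * c) + 2 + 4 * c"
  have C': "C' > 0" using c C by (simp add: C'_def)
  have 3: "\<forall>\<^sub>F w in sequentially.
             2 * exp (c * real w) * (1 + 2 * C' * 2 ^ w * real w ^ 2) \<le> exp (2 ^ w / real w powr C / 4)"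
    using C c C' by real_asymp
  have "\<forall>\<^sub>F w in sequentially. \<exists>(Y::int) E b N W. Y \<ge> 3 \<and> W > 0 \<and> W \<le> 2 ^ w \<and>
           2 ^ w \<le> real w powr C' * W \<and> ln (real_of_int Y) \<le> C' * W * real w ^ 2 \<and>
           real E \<le> exp (C' * real w ^ 2) \<and> real b \<le> C' * W * real w ^ 2 \<and> exp (W / 4) \<le> real N \<and>
           (\<forall>t\<ge>1. N choose t \<le> card {n. carmichael a n \<and> n \<le> Y ^ (1 + t + E * b)})"
    using ev F 3 eventually_ge_at_top[of 1]
  proof eventually_elim
    case (elim w)
    then obtain Q :: "int set" and l where Q: "finite Q" "l \<ge> 1"
      "\<And>q. q \<in> Q \<Longrightarrow> prime q \<and> q > T \<and> q - 1 dvd int l \<and> ln (real_of_int q) \<le> C * real w ^ 2"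
      "ln (real l) \<le> C * real w ^ 2" "2 ^ w \<le> real w powr C * real (card Q)" "card Q \<le> 2 ^ w"
      by blast
    have w: "real w \<ge> 1" using elim by simp
    have ww: "real w \<le> real w ^ 2" "1 \<le> real w ^ 2" using w mult_mono[of 1 "real w" 1 "real w"] by (auto simp: power2_eq_square mult_le_cancel_left1)
    have "(0::real) < 2 ^ w" by simp
    with Q(5) have "Q \<noteq> {}" by (metis card.empty mult_zero_right not_less of_nat_0)
    define W where "W = real (card Q)"
    have W: "W \<ge> 1" using \<open>Q \<noteq> {}\<close> Q(1) by (simp add: W_def Suc_leI card_gt_0_iff)
    have W2: "W \<le> 2 ^ w" unfolding W_def using Q(6) by (metis of_nat_le_iff of_nat_numeral of_nat_power)
    obtain L where L: "L = \<Prod>Q" by simp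
    have "L > 0" unfolding L using Q(3) by (intro prod_pos) (auto dest: prime_gt_0_int)
    hence L1: "real_of_int L \<ge> 1" by linarith
    have "ln (real_of_int L) \<le> W * (C * real w ^ 2)"
      unfolding L W_def using Q(3) by (intro ln_prod_le) (auto dest: prime_gt_0_int)
    hence lnL: "ln (real_of_int L) \<le> W * C * real w ^ 2" by (simp add: mult.assoc)
    also have "\<dots> \<le> 2 ^ w * C * real w ^ 2" using W2 C by (intro mult_right_mono) auto
    finally have lnL2: "ln (real_of_int L) \<le> 2 ^ w * C * real w ^ 2" .
    obtain K where K_def: "K = 3 * B * ln (3 * real_of_int L) powr A + 1" by simp
    obtain K' where K'_def: "K' = 3 * B * ln (3 * (real_of_int L * K)) powr A + 1" by simp
    obtain H where H_def: "H = real_of_int L * K * K'" by simp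
    have K1: "K \<ge> 1" "K' \<ge> 1" using lpb by (simp_all add: K_def K'_def)
    have "K \<le> F w 0" unfolding K_def F_def using lnL2 lpb(2,3) L1 ln_3_le_2
      by (intro add_mono mult_left_mono powr_mono2) (auto simp: ln_mult)
    also have "F w 0 \<le> exp (c * real w)" using elim(2) c by simp
    finally have Ke: "K \<le> exp (c * real w)" .
    hence lnK: "ln K \<le> c * real w" using ln_mono[of K "exp (c * real w)"] K1 by simp
    have "K' \<le> F w (c * real w)" unfolding K'_def F_def using lnL2 lnK lpb(2,3) L1 K1 ln_3_le_2
      by (intro add_mono mult_left_mono powr_mono2) (auto simp: ln_mult ln_ge_zero mult_ge1_I)
    also have "F w (c * real w) \<le> exp (c * real w)" using elim(2) c by simp
    finally have K'e: "K' \<le> exp (c * real w)" .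
    hence lnK': "ln K' \<le> c * real w" using ln_mono[of K' "exp (c * real w)"] K1 by simp
    have mW: "x * real w \<le> x * W * real w ^ 2" if "x > 0" for x
    proof -
      have "real w \<le> W * real w ^ 2" using ww W mult_mono[of 1 W "real w" "real w ^ 2"] by simp
      thus ?thesis using that by (simp add: mult.assoc)
    qed
    have lnH: "ln H \<le> (C + 2 * c) * W * real w ^ 2"
    proof -
      have "ln H = ln (real_of_int L) + ln K + ln K'" using L1 K1 by (simp add: H_def ln_mult)
      also have "\<dots> \<le> W * C * real w ^ 2 + c * W * real w ^ 2 + c * W * real w ^ 2"
        using lnL lnK lnK' mW[OF c] by linarith
      finally show ?thesis by (simp add: algebra_simps)
    qed
    have one: "1 \<le> W * real w ^ 2" using mult_mono[of 1 W 1 "real w ^ 2"] W ww by simp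
    have lnH': "2 * ln H + 1 \<le> C' * W * real w ^ 2"
    proof -
      have "2 * ln H + 1 \<le> (2 * (C + 2 * c)) * (W * real w ^ 2) + 1 * (W * real w ^ 2)"
        using lnH one unfolding mult.assoc[of 2] mult.assoc[of "C + 2 * c"] by linarith
      also have "\<dots> \<le> C' * (W * real w ^ 2)" unfolding distrib_right[symmetric]
        using c one by (intro mult_right_mono) (auto simp: C'_def)
      finally show ?thesis by (simp add: mult.assoc)
    qed
    have QT: "prime q \<and> q > T" "q - 1 dvd int l" if "q \<in> Q" for q using Q(3)[OF that] by auto
    have T: "T \<ge> 2 * \<bar>a\<bar> + 3" by (simp add: T_def)
    obtain Y :: int and E b N where Y: "Y \<ge> 3" "real_of_int Y \<le> 2 * H"
      and E: "real E \<le> real l * (K * K')\<^sup>2" and b: "real b \<le> 2 * ln H + 1"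
      and N: "2 ^ card Q \<le> 2 * K * (real N + real b)"
      and main: "\<forall>t\<ge>1. (N - b) choose t \<le> card {n. carmichael a n \<and> n \<le> Y ^ (1 + t + E * b)}"
      using ex_carmichael_choose_bound[OF lpb a T Q(1) \<open>Q \<noteq> {}\<close> QT Q(2) L K_def K'_def H_def] by blast
    have H1: "H > 0" using L1 K1 by (auto simp: H_def intro!: mult_pos_pos)
    have lnY: "ln (real_of_int Y) \<le> C' * W * real w ^ 2"
    proof -
      have "ln (real_of_int Y) \<le> ln (2 * H)" using Y by (intro ln_mono) auto
      also have "\<dots> \<le> 1 + ln H" using H1 ln_le_minus_one[of "2::real"] by (simp add: ln_mult)
      also have "\<dots> \<le> 2 * ln H + 1"
        using L1 K1 by (simp add: H_def ln_mult)
      finally show ?thesis using lnH' by linarith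
    qed
    have bW: "real b \<le> C' * W * real w ^ 2" using b lnH' by linarith
    have Ee: "real E \<le> exp (C' * real w ^ 2)"
    proof -
      have "real l \<le> exp (C * real w ^ 2)" using Q(2,4) by (metis exp_ln exp_le_cancel_iff of_nat_0_less_iff less_eq_Suc_le One_nat_def)
      moreover have "(K * K')\<^sup>2 \<le> (exp (c * real w) * exp (c * real w))\<^sup>2"
        using Ke K'e K1 by (intro power_mono mult_mono) auto
      ultimately have "real l * (K * K')\<^sup>2 \<le> exp (C * real w ^ 2) * (exp (c * real w) * exp (c * real w))\<^sup>2"
        by (intro mult_mono) auto
      also have "\<dots> = exp (C * real w ^ 2 + 4 * c * real w)"
        by (simp add: power2_eq_square exp_add[symmetric] algebra_simps)
      also have "C * real w ^ 2 + 4 * c * real w \<le> (C + 4 * c) * real w ^ 2"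
        using ww c by (simp add: algebra_simps)
      also have "\<dots> \<le> C' * real w ^ 2" using c C by (intro mult_right_mono) (auto simp: C'_def)
      finally show ?thesis using E by simp
    qed
    \<comment> \<open>\<open>2 ^ card Q\<close> is at least \<open>exp (W / 2)\<close>. One factor
      \<open>exp (W / 4)\<close> pays for \<open>2 * K * (1 + 2 * b)\<close>, the other remains; the
      \<open>2 * b\<close> covers both the \<open>b\<close> added to \<open>N\<close> and the
      \<open>b\<close> subtracted from it.\<close>
    have "exp (W / 4) \<le> real (N - b)"
    proof -
      have b2: "real b \<le> C' * 2 ^ w * real w ^ 2"
      proof -
        have "C' * W * real w ^ 2 \<le> C' * 2 ^ w * real w ^ 2"
          using W2 c C by (intro mult_right_mono mult_left_mono) (auto simp: C'_def)
        thus ?thesis using bW by linarith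
      qed
      have "2 ^ w / real w powr C \<le> W" using Q(5) w by (simp add: W_def field_simps)
      hence "2 * exp (c * real w) * (1 + 2 * C' * 2 ^ w * real w ^ 2) \<le> exp (W / 4)"
        using elim by (smt (verit) exp_le_cancel_iff divide_right_mono)
      moreover have "2 * K * (1 + 2 * real b) \<le> 2 * exp (c * real w) * (1 + 2 * C' * 2 ^ w * real w ^ 2)"
        using Ke K1 b2 by (intro mult_mono) auto
      ultimately have "2 * K * (1 + 2 * real b) \<le> exp (W / 4)" by linarith
      hence "exp (W / 4) * (2 * K * (1 + 2 * real b)) \<le> exp (W / 4) * exp (W / 4)" by (intro mult_left_mono) auto
      also have "\<dots> = exp (W * (1 / 2))" by (simp add: exp_add[symmetric])
      also have "\<dots> \<le> exp (W * ln 2)" using ln_2_ge_half W by simp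
      also have "\<dots> = 2 ^ card Q" by (simp add: W_def exp_of_nat_mult)
      also have "\<dots> \<le> 2 * K * (real N + real b)" by (rule N)
      finally have "2 * K * (exp (W / 4) * (1 + 2 * real b)) \<le> 2 * K * (real N + real b)" by (simp only: mult_ac)
      hence "exp (W / 4) * (1 + 2 * real b) \<le> real N + real b" using K1 by simp
      moreover have "2 * real b * 1 \<le> 2 * real b * exp (W / 4)" using W by (intro mult_left_mono) auto
      ultimately show ?thesis by (simp add: algebra_simps)
    qed
    moreover have "2 ^ w \<le> real w powr C' * W"
    proof -
      have "real w powr C \<le> real w powr C'" using w c C by (intro powr_mono) (auto simp: C'_def)
      hence "real w powr C * W \<le> real w powr C' * W" using W by (intro mult_right_mono) auto
      thus ?thesis using Q(5) by (simp add: W_def)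
    qed
    moreover have "W > 0" using W by simp
    ultimately show ?case using Y(1) W2 lnY Ee bW main by blast
  qed
  moreover have "C' > 0" using c C by (simp add: C'_def)
  ultimately show ?thesis by blast
qed

section \<open>The density bound\<close>

lemma finite_carmichael_le: "finite {n. carmichael a n \<and> real_of_int n \<le> X}"
  by (rule finite_subset[of _ "{1..\<lfloor>X\<rfloor>}"]) (auto simp: carmichael_def le_floor_iff)

text \<open>Since \<open>N choose t\<close> is at least \<open>(N / t) ^ t\<close>, it is enough
  that \<open>t\<close> takes up at most the square root of \<open>exp W\<close>.\<close>

lemma exp_power_le_choose:
  assumes "t \<ge> 1" "real t \<le> exp (W / 2)" "exp W \<le> real N" "W \<ge> 0"
  shows "exp (W / 2 * real t) \<le> real (N choose t)"
proof -
  have "exp (W / 2) \<le> exp W" using assms(4) by simp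
  hence "t \<le> N" using assms by linarith
  have "exp (W / 2) * real t \<le> exp (W / 2) * exp (W / 2)" using assms(2) by (intro mult_left_mono) auto
  also have "\<dots> = exp W" by (simp add: exp_add[symmetric])
  finally have "exp (W / 2) \<le> real N / real t" using assms(1,3) by (simp add: field_simps)
  hence "exp (W / 2) ^ t \<le> (real N / real t) ^ t" by (intro power_mono) auto
  also have "\<dots> \<le> real (N choose t)" using \<open>t \<le> N\<close> by (rule binomial_ge_n_over_k_pow_k)
  finally show ?thesis by (simp add: exp_of_nat_mult[symmetric] mult.commute)
qed

text \<open>The lower bound on \<open>ln X\<close> makes \<open>t\<close>, about
  \<open>ln X / (2 * ln Y)\<close>, exceed \<open>E * b\<close>, so the powers from \<open>R\<close>
  at most double the exponent. The upper bound keeps \<open>t\<close> below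
  \<open>exp (W / 8)\<close> for the binomial estimate. The logarithm of the count is then at least
  \<open>W * t / 8\<close>, while \<open>ln X\<close> is O(W w^2 t).\<close>

lemma eventually_card_carmichael_ge:
  fixes a :: int
  assumes lpb: "least_prime_bound A B" "A > 0" "B > 0" and a: "a \<noteq> 0"
  shows "\<exists>C>0. \<forall>\<^sub>F w in sequentially. \<forall>X>0. exp (C * real w ^ 2) \<le> ln X \<longrightarrow>
           ln X \<le> exp (2 ^ w / (C * real w powr C)) \<longrightarrow>
           X powr (1 / (C * real w ^ 2)) \<le> real (card {n. carmichael a n \<and> real_of_int n \<le> X})"
proof -
  obtain C where C: "C > 0" and ev: "\<forall>\<^sub>F w in sequentially. \<exists>(Y::int) E b N W. Y \<ge> 3 \<and> W > 0 \<and> W \<le> 2 ^ w \<and>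
           2 ^ w \<le> real w powr C * W \<and> ln (real_of_int Y) \<le> C * W * real w ^ 2 \<and>
           real E \<le> exp (C * real w ^ 2) \<and> real b \<le> C * W * real w ^ 2 \<and> exp (W / 4) \<le> real N \<and>
           (\<forall>t\<ge>1. N choose t \<le> card {n. carmichael a n \<and> n \<le> Y ^ (1 + t + E * b)})"
    using eventually_carmichael_choose_bound[OF lpb a] by blast
  \<comment> \<open>\<open>32 * C\<close> is the product of 8 from \<open>W / 8\<close> and 4 from
    \<open>ln X <= 4 * C * W * w^2 * t\<close>; the 8 gives \<open>W / C' <= W / 8\<close>.\<close>
  define C' where "C' = 32 * C + 8"
  have "\<forall>\<^sub>F w in sequentially. 2 * (C * 2 ^ w * real w ^ 2) * (2 + exp (C * real w ^ 2) * (C * 2 ^ w * real w ^ 2)) \<le> exp (2 * C * real w ^ 2)"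
    using C by real_asymp
  hence "\<forall>\<^sub>F w in sequentially. \<forall>X>0. exp (C' * real w ^ 2) \<le> ln X \<longrightarrow>
           ln X \<le> exp (2 ^ w / (C' * real w powr C')) \<longrightarrow>
           X powr (1 / (C' * real w ^ 2)) \<le> real (card {n. carmichael a n \<and> real_of_int n \<le> X})"
    using ev eventually_ge_at_top[of 1]
  proof (eventually_elim, intro allI impI)
    fix w :: nat and X :: real
    assume asy: "2 * (C * 2 ^ w * real w ^ 2) * (2 + exp (C * real w ^ 2) * (C * 2 ^ w * real w ^ 2)) \<le> exp (2 * C * real w ^ 2)"
      and "1 \<le> w" and X: "X > 0" "exp (C' * real w ^ 2) \<le> ln X" "ln X \<le> exp (2 ^ w / (C' * real w powr C'))"
    assume "\<exists>(Y::int) E b N W. Y \<ge> 3 \<and> W > 0 \<and> W \<le> 2 ^ w \<and>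
           2 ^ w \<le> real w powr C * W \<and> ln (real_of_int Y) \<le> C * W * real w ^ 2 \<and>
           real E \<le> exp (C * real w ^ 2) \<and> real b \<le> C * W * real w ^ 2 \<and> exp (W / 4) \<le> real N \<and>
           (\<forall>t\<ge>1. N choose t \<le> card {n. carmichael a n \<and> n \<le> Y ^ (1 + t + E * b)})"
    then obtain Y :: int and E b N W where Y: "Y \<ge> 3" and W: "W > 0" "W \<le> 2 ^ w"
      "2 ^ w \<le> real w powr C * W" and lnY: "ln (real_of_int Y) \<le> C * W * real w ^ 2"
      and E: "real E \<le> exp (C * real w ^ 2)" and b: "real b \<le> C * W * real w ^ 2" and N: "exp (W / 4) \<le> real N"
      and main: "\<And>t. t \<ge> 1 \<Longrightarrow> N choose t \<le> card {n. carmichael a n \<and> n \<le> Y ^ (1 + t + E * b)}"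
      by blast
    have w: "real w \<ge> 1" using \<open>1 \<le> w\<close> by simp
    have C'1: "C' \<ge> 1" "C' \<ge> C" "C' \<ge> 2 * C" using C by (simp_all add: C'_def)
    define y where "y = ln (real_of_int Y)"
    have y1: "y \<ge> 1"
    proof -
      have "exp 1 \<le> real_of_int Y" using Y exp_le by linarith
      hence "ln (exp 1) \<le> y" unfolding y_def using Y by (intro ln_mono) auto
      thus ?thesis by simp
    qed
    have CW: "C * W * real w ^ 2 \<le> C * 2 ^ w * real w ^ 2"
      using W C by (intro mult_right_mono mult_left_mono) auto
    have y2: "y \<le> C * 2 ^ w * real w ^ 2" using lnY CW by (simp add: y_def)
    have b2: "real b \<le> C * 2 ^ w * real w ^ 2" using b CW by linarith
    \<comment> \<open>Chosen so that \<open>Y ^ (2 * t) <= X\<close> for \<open>t <= u\<close>,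
      leaving half of the exponent for \<open>1 + E * b\<close>.\<close>
    define u where "u = ln X / (2 * y)"
    have u: "2 + real (E * b) \<le> u"
    proof -
      have "2 * y * (2 + real E * real b) \<le>
          2 * (C * 2 ^ w * real w ^ 2) * (2 + exp (C * real w ^ 2) * (C * 2 ^ w * real w ^ 2))"
        using y1 y2 b2 E C by (intro mult_mono add_mono) auto
      also have "\<dots> \<le> exp (2 * C * real w ^ 2)" by (rule asy)
      also have "\<dots> \<le> exp (C' * real w ^ 2)" using C'1 by (simp add: mult_right_mono)
      also have "\<dots> \<le> ln X" by (rule X(2))
      finally show ?thesis using y1 by (simp add: u_def field_simps)
    qed
    define t where "t = nat \<lfloor>u\<rfloor>"
    have u0: "u \<ge> 2" using u by (smt (verit) of_nat_0_le_iff)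
    have t_u: "real t \<le> u" "u < real t + 1" using u0 unfolding t_def by linarith+
    have "real (1 + E * b) < real t + 1" using u t_u by simp
    hence t: "1 + E * b \<le> t" by linarith
    have "u \<le> ln X" using y1 u0 unfolding u_def by (smt (verit) divide_le_eq_1 frac_le divide_self_if div_by_1 zero_le_divide_iff)
    have "real w powr C \<le> real w powr C'" using w C'1 by (intro powr_mono) auto
    hence "real w powr C * W \<le> real w powr C' * W" using W by (intro mult_right_mono) auto
    hence "2 ^ w \<le> real w powr C' * W" using W by linarith
    hence "2 ^ w / (C' * real w powr C') \<le> W / C'" using w C'1 by (simp add: field_simps)
    also have "\<dots> \<le> W / 4 / 2" using W C by (simp add: C'_def field_simps)
    finally have "exp (2 ^ w / (C' * real w powr C')) \<le> exp (W / 4 / 2)" by simp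
    hence t_le: "real t \<le> exp (W / 4 / 2)" using X(3) \<open>u \<le> ln X\<close> t_u by linarith
    have choose: "exp (W / 4 / 2 * real t) \<le> real (N choose t)"
      by (rule exp_power_le_choose) (use t t_le N W in auto)
    have Yt: "real_of_int (Y ^ (1 + t + E * b)) \<le> X"
    proof -
      have Y1: "real_of_int Y \<ge> 1" using Y by simp
      have "real_of_int (Y ^ (1 + t + E * b)) \<le> real_of_int Y ^ (2 * t)"
        unfolding of_int_power using t Y1 by (intro power_increasing) auto
      also have "\<dots> = exp (real (2 * t) * y)" using Y by (simp add: y_def exp_of_nat_mult del: of_nat_mult)
      also have "real (2 * t) * y \<le> ln X" using t_u(1) y1 by (simp add: u_def field_simps)
      finally show ?thesis using X(1) by simp
    qed
    have "ln X / (C' * real w ^ 2) \<le> W / 4 / 2 * real t"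
    proof -
      have "ln X = 2 * y * u" using y1 by (simp add: u_def)
      also have "\<dots> \<le> 2 * (C * W * real w ^ 2) * (2 * real t)"
        using t_u t y1 u0 lnY by (intro mult_mono) (auto simp: y_def)
      also have "\<dots> \<le> C' * real w ^ 2 * (W / 4 / 2 * real t)"
        using W C w by (simp add: C'_def field_simps)
      finally show ?thesis using w C'1 by (simp add: field_simps)
    qed
    hence "X powr (1 / (C' * real w ^ 2)) \<le> exp (W / 4 / 2 * real t)" using X(1) by (simp add: powr_def)
    also have "\<dots> \<le> real (N choose t)" by (rule choose)
    also have "\<dots> \<le> real (card {n. carmichael a n \<and> n \<le> Y ^ (1 + t + E * b)})"
      using main[of t] t by simp
    also have "\<dots> \<le> real (card {n. carmichael a n \<and> real_of_int n \<le> X})"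
    proof -
      have "real_of_int n \<le> X" if "n \<le> Y ^ (1 + t + E * b)" for n
        using Yt that by (meson of_int_le_iff order_trans)
      thus ?thesis by (intro of_nat_mono card_mono finite_carmichael_le) auto
    qed
    finally show "X powr (1 / (C' * real w ^ 2)) \<le> real (card {n. carmichael a n \<and> real_of_int n \<le> X})" .
  qed
  moreover have "C' > 0" using C by (simp add: C'_def)
  ultimately show ?thesis by blast
qed

text \<open>For \<open>a = 0\<close> the divisibility condition is trivial, so every composite
  qualifies; the even ones already give a linear count.\<close>

lemma carmichael_0_even:
  assumes "n > 2" "even n"
  shows "carmichael 0 n"
proof -
  have "\<not> prime n" using assms primes_dvd_imp_eq[of 2 n] by auto
  thus ?thesis using assms by (simp add: carmichael_def)
qed

lemma card_carmichael_0_ge: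
  assumes "X \<ge> 0"
  shows "X / 2 - 2 \<le> real (card {n. carmichael 0 n \<and> real_of_int n \<le> X})"
proof -
  have "card {2..\<lfloor>X / 2\<rfloor>} \<le> card {n. carmichael 0 n \<and> real_of_int n \<le> X}"
    by (rule card_inj_on_le[where f = "\<lambda>i. 2 * i"])
       (auto intro!: inj_onI carmichael_0_even finite_carmichael_le simp: le_floor_iff)
  moreover have "X / 2 - 2 \<le> real (card {2..\<lfloor>X / 2\<rfloor>})" using assms by simp linarith
  ultimately show ?thesis by linarith
qed

lemma carmichael_density:
  fixes a :: int
  assumes lpb: "least_prime_bound A B" "A > 0" "B > 0"
  shows "\<exists>C>0. \<forall>\<^sub>F X::real in at_top.
           X powr (C / (ln (ln (ln X)))\<^sup>2) \<le> real (card {n. carmichael a n \<and> real_of_int n \<le> X})"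
proof (cases "a = 0")
  case True
  have "\<forall>\<^sub>F X::real in at_top. X powr (1 / (ln (ln (ln X)))\<^sup>2) \<le> X / 2 - 2" by real_asymp
  hence "\<forall>\<^sub>F X::real in at_top.
           X powr (1 / (ln (ln (ln X)))\<^sup>2) \<le> real (card {n. carmichael a n \<and> real_of_int n \<le> X})"
    using eventually_ge_at_top[of 0]
    by eventually_elim (use True card_carmichael_0_ge order_trans in blast)
  thus ?thesis by (intro exI[of _ 1]) auto
next
  case False
  obtain C where C: "C > 0" and ev: "\<forall>\<^sub>F w in sequentially. \<forall>X>0. exp (C * real w ^ 2) \<le> ln X \<longrightarrow>
           ln X \<le> exp (2 ^ w / (C * real w powr C)) \<longrightarrow>
           X powr (1 / (C * real w ^ 2)) \<le> real (card {n. carmichael a n \<and> real_of_int n \<le> X})"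
    using eventually_card_carmichael_ge[OF lpb False] by blast
  \<comment> \<open>Any factor above \<open>1 / ln 2\<close> would do: it makes \<open>2 ^ w\<close> a power of \<open>ln (ln X)\<close> with exponent above 1.\<close>
  define w where "w X = nat \<lceil>3 * ln (ln (ln X))\<rceil>" for X :: real
  have "filterlim w sequentially at_top" unfolding w_def by real_asymp
  from eventually_compose_filterlim[OF ev this]
  have 1: "\<forall>\<^sub>F X in at_top. \<forall>Z>0. exp (C * real (w X) ^ 2) \<le> ln Z \<longrightarrow>
           ln Z \<le> exp (2 ^ w X / (C * real (w X) powr C)) \<longrightarrow>
           Z powr (1 / (C * real (w X) ^ 2)) \<le> real (card {n. carmichael a n \<and> real_of_int n \<le> Z})" .
  have 2: "\<forall>\<^sub>F X::real in at_top. exp (C * (4 * ln (ln (ln X))) ^ 2) \<le> ln X"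
    using C by real_asymp
  \<comment> \<open>4/3 lies strictly between 1 and 3/2, which is at most \<open>3 * ln 2\<close>.
    Exceeding 1, it makes the numerator a power of \<open>ln (ln X)\<close> that outweighs both
    \<open>ln (ln X)\<close> and the denominator.\<close>
  have 3: "\<forall>\<^sub>F X::real in at_top. ln X \<le> exp (exp (4/3 * ln (ln (ln X))) / (C * (4 * ln (ln (ln X))) powr C))"
    using C by real_asymp
  have 4: "\<forall>\<^sub>F X::real in at_top. ln (ln (ln X)) \<ge> 1" by real_asymp
  define C' where "C' = 1 / (16 * C)"
  have "\<forall>\<^sub>F X::real in at_top.
           X powr (C' / (ln (ln (ln X)))\<^sup>2) \<le> real (card {n. carmichael a n \<and> real_of_int n \<le> X})"
    using 1 2 3 4 eventually_ge_at_top[of 1]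
  proof eventually_elim
    case (elim X)
    define v where "v = ln (ln (ln X))"
    have v: "v \<ge> 1" using elim by (simp add: v_def)
    have w: "3 * v \<le> real (w X)" "real (w X) \<le> 4 * v" using v unfolding w_def v_def[symmetric] by linarith+
    have sq: "real (w X) ^ 2 \<le> (4 * v) ^ 2" using w v by (intro power_mono) auto
    have "exp (C * real (w X) ^ 2) \<le> exp (C * (4 * v) ^ 2)" using sq C by simp
    hence a: "exp (C * real (w X) ^ 2) \<le> ln X" using elim(2) unfolding v_def by linarith
    have "exp (4 / 3 * v) \<le> 2 ^ w X"
    proof -
      have "4 / 3 * v \<le> real (w X) * ln 2" 
      proof -
        have "3 * v * (1 / 2) \<le> real (w X) * ln 2" using w v ln_2_ge_half by (intro mult_mono) auto
        thus ?thesis using v by linarith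
      qed
      hence "exp (4 / 3 * v) \<le> exp (real (w X) * ln 2)" by simp
      thus ?thesis by (simp add: exp_of_nat_mult)
    qed
    hence "exp (4 / 3 * v) / (C * (4 * v) powr C) \<le> 2 ^ w X / (C * real (w X) powr C)"
      using w v C by (intro frac_le mult_left_mono powr_mono2) auto
    hence "exp (exp (4 / 3 * v) / (C * (4 * v) powr C)) \<le> exp (2 ^ w X / (C * real (w X) powr C))" by simp
    hence b: "ln X \<le> exp (2 ^ w X / (C * real (w X) powr C))" using elim(3) unfolding v_def by linarith
    have "C' / v\<^sup>2 = 1 / (C * (4 * v) ^ 2)" by (simp add: C'_def power_mult_distrib)
    also have "\<dots> \<le> 1 / (C * real (w X) ^ 2)" using sq C w v by (intro frac_le mult_left_mono) auto
    finally have "X powr (C' / v\<^sup>2) \<le> X powr (1 / (C * real (w X) ^ 2))" using elim by (intro powr_mono) auto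
    also have "\<dots> \<le> real (card {n. carmichael a n \<and> real_of_int n \<le> X})" using elim(1,5) a b by simp
    finally show ?case by (simp add: v_def)
  qed
  moreover have "C' > 0" using C by (simp add: C'_def)
  ultimately show ?thesis by blast
qed

theorem theorem1:
  assumes "least_prime_conjecture"
  shows "(\<forall>a::int. infinite {n. carmichael a n}) \<and>
         (\<forall>a::int. \<exists>C>0. \<exists>c\<^sub>0>0. \<forall>\<^sub>F X::real in at_top.
            real (card {n. carmichael a n \<and> real_of_int n \<le> X})
              \<ge> c\<^sub>0 * X powr (C / (ln (ln (ln X)))\<^sup>2))"
proof -
  obtain A B where AB: "A > 0" "B > 0" "least_prime_bound A B"
    using assms unfolding least_prime_conjecture_def least_prime_bound_def smallest_prime_in_class_def coprime_iff_gcd_eq_1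
    by meson
  note density = carmichael_density[OF AB(3,1,2)]
  show ?thesis
  proof (intro conjI allI notI)
    fix a :: int assume fin: "finite {n. carmichael a n}"
    obtain C where C: "C > 0" and lower: "\<forall>\<^sub>F X::real in at_top.
        X powr (C / (ln (ln (ln X)))\<^sup>2) \<le> real (card {n. carmichael a n \<and> real_of_int n \<le> X})"
      using density by blast
    \<comment> \<open>The lower bound is unbounded because \<open>ln X\<close> outgrows the square
      of its double logarithm.\<close>
    have "filterlim (\<lambda>X::real. X powr (C / (ln (ln (ln X)))\<^sup>2)) at_top at_top"
      using C by real_asymp
    hence "\<forall>\<^sub>F X::real in at_top. real (card {n. carmichael a n}) + 1 \<le> X powr (C / (ln (ln (ln X)))\<^sup>2)"
      unfolding filterlim_at_top by blast
    with lower have "\<forall>\<^sub>F X::real in at_top. False"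
    proof eventually_elim
      case (elim X)
      have "card {n. carmichael a n \<and> real_of_int n \<le> X} \<le> card {n. carmichael a n}"
        using fin by (intro card_mono) auto
      with elim show ?case by linarith
    qed
    thus False by simp
  next
    fix a :: int
    show "\<exists>C>0. \<exists>c\<^sub>0>0. \<forall>\<^sub>F X::real in at_top.
            real (card {n. carmichael a n \<and> real_of_int n \<le> X}) \<ge> c\<^sub>0 * X powr (C / (ln (ln (ln X)))\<^sup>2)"
    proof -
      obtain C where "C > 0" "\<forall>\<^sub>F X::real in at_top.
          X powr (C / (ln (ln (ln X)))\<^sup>2) \<le> real (card {n. carmichael a n \<and> real_of_int n \<le> X})"
        using density by blast
      thus ?thesis by (intro exI[of _ C] conjI exI[of _ 1]) auto
    qed
  qed
qed

end
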